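(* Let $X=(X_1,X_2)$ be a two-good random valuation whose two coordinates $X_1,X_2$ are independent. Then \[ \frac{\textsc{SRev}(X_1,X_2)}{\textsc{Rev}(X_1,X_2)}\;\geq\;\frac{\sqrt{e}}{\sqrt{e}+1}\approx 0.62 . \]
   Context: A $k$-good random valuation is a random vector $X=(X_1,\dots,X_k)$ taking values in $\mathbb{R}_+^k$ (the buyer's values for the goods; the buyer's value for a set of goods is the sum of the values). A (direct) mechanism is a pair $\mu=(q,s)$ of Borel functions $q=(q_1,\dots,q_k):\mathbb{R}_+^k\to[0,1]^k$ (allocation probabilities) and $s:\mathbb{R}_+^k\to\mathbb{R}$ (payment); the buyer's payoff is $b(x)=q(x)\cdot x-s(x)$. The mechanism is individually rational (IR) if $b(x)\ge 0$ for all $x\in\mathbb{R}_+^k$, and incentive compatible (IC) if $b(x)\ge q(\tilde x)\cdot x-s(\tilde x)$ for all $x,\tilde x\in\mathbb{R}_+^k$. The revenue of $\mu$ from $X$ is $R(\mu;X)=\mathbb{E}[s(X)]$, and $\textsc{Rev}(X)=\sup_\mu R(\mu;X)$ over all IC and IR mechanisms. For a one-good valuation this is the optimal one-good revenue, and $\textsc{SRev}(X)=\textsc{Rev}(X_1)+\dots+\textsc{Rev}(X_k)$ is the separate-selling revenue. *)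

theory Defs
  imports "HOL-Probability.Probability" "HOL-Library.Numeral_Type"
begin

text \<open>Valuations of k goods are vectors in real^'k (index type 'k = number of goods).
  The nonnegative orthant R_+^k:\<close>
definition nonneg_orthant :: "(real^'k::finite) set" where
  "nonneg_orthant = {x. \<forall>i. 0 \<le> x $ i}"

definition IC_IR_mechanism :: "((real^'k::finite) \<Rightarrow> real^'k) \<Rightarrow> (real^'k \<Rightarrow> real) \<Rightarrow> bool" where
  "IC_IR_mechanism q s \<longleftrightarrow>
     q \<in> borel_measurable borel \<and> s \<in> borel_measurable borel \<and>
     (\<forall>x\<in>nonneg_orthant. \<forall>i. 0 \<le> q x $ i \<and> q x $ i \<le> 1) \<and>
     (\<forall>x\<in>nonneg_orthant. q x \<bullet> x - s x \<ge> 0) \<and>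
     (\<forall>x\<in>nonneg_orthant. \<forall>x'\<in>nonneg_orthant. q x \<bullet> x - s x \<ge> q x' \<bullet> x - s x')"

definition pos_pay :: "'a measure \<Rightarrow> ('a \<Rightarrow> real^'k::finite) \<Rightarrow> (real^'k \<Rightarrow> real) \<Rightarrow> ennreal" where
  "pos_pay M X s = (\<integral>\<^sup>+ \<omega>. ennreal (s (X \<omega>)) \<partial>M)"

definition neg_pay :: "'a measure \<Rightarrow> ('a \<Rightarrow> real^'k::finite) \<Rightarrow> (real^'k \<Rightarrow> real) \<Rightarrow> ennreal" where
  "neg_pay M X s = (\<integral>\<^sup>+ \<omega>. ennreal (- s (X \<omega>)) \<partial>M)"

definition revenue :: "'a measure \<Rightarrow> ('a \<Rightarrow> real^'k::finite) \<Rightarrow> (real^'k \<Rightarrow> real) \<Rightarrow> ereal" where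
  "revenue M X s = enn2ereal (pos_pay M X s) - enn2ereal (neg_pay M X s)"

text \<open>Rev(X): supremum of revenue over IC and IR mechanisms whose expected payment is defined
  (not of the form infinity minus infinity).\<close>
definition Rev :: "'a measure \<Rightarrow> ('a \<Rightarrow> real^'k::finite) \<Rightarrow> ereal" where
  "Rev M X = (SUP qs \<in> {(q, s). IC_IR_mechanism q s \<and>
                         \<not> (pos_pay M X s = \<top> \<and> neg_pay M X s = \<top>)}.
                 revenue M X (snd qs))"

definition one_good :: "('a \<Rightarrow> real) \<Rightarrow> 'a \<Rightarrow> real^1" where
  "one_good Y = (\<lambda>\<omega>. vector [Y \<omega>])"

definition two_goods :: "('a \<Rightarrow> real) \<Rightarrow> ('a \<Rightarrow> real) \<Rightarrow> 'a \<Rightarrow> real^2" where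
  "two_goods Y1 Y2 = (\<lambda>\<omega>. vector [Y1 \<omega>, Y2 \<omega>])"

definition SRev2 :: "'a measure \<Rightarrow> ('a \<Rightarrow> real) \<Rightarrow> ('a \<Rightarrow> real) \<Rightarrow> ereal" where
  "SRev2 M Y1 Y2 = Rev M (one_good Y1) + Rev M (one_good Y2)"

end

theory Submission
  imports Defs
begin

text \<open>
  Let \<open>b\<close> be the buyer's payoff, normalised to \<open>b(0) = 0\<close>, and on the diagonal put
  \<open>\<phi>(t) = q\<^sub>1(t,t)\<close>, \<open>\<psi>(t) = q\<^sub>2(t,t)\<close>, \<open>\<beta>(t) = b(t,t)\<close>; write \<open>z = min(x\<^sub>1,x\<^sub>2)\<close>. On
  \<open>x\<^sub>1 \<ge> x\<^sub>2\<close>, for fixed \<open>x\<^sub>2\<close>, the part of the payment in excess of \<open>x\<^sub>2 \<phi>(x\<^sub>2) - \<beta>(x\<^sub>2) + x\<^sub>2 q\<^sub>2(x)\<close>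
  is, up to the factor \<open>1 - \<phi>(x\<^sub>2)\<close>, a one-good mechanism for \<open>X\<^sub>1\<close>, and \<open>q\<^sub>2(x) \<le> \<psi>(x\<^sub>1)\<close> by
  monotonicity; the same holds on \<open>x\<^sub>2 \<ge> x\<^sub>1\<close>. With \<open>r\<^sub>i\<close> the one-good revenues this bounds the revenue by
  \<open>r\<^sub>1 + r\<^sub>2 + E[\<phi>(X\<^sub>2)(z - r\<^sub>1) + \<psi>(X\<^sub>1)(z - r\<^sub>2) - \<beta>(z)]\<close>.

  The function \<open>m = min(1, \<phi> + \<psi>)\<close> is monotone, dominates \<open>\<phi>\<close> and \<open>\<psi>\<close>, and \<open>\<beta>(z) \<ge> \<integral>\<^sub>0\<^sup>z m\<close>.
  Writing \<open>m\<close> as an average of indicators of \<open>[p,\<infinity>)\<close> reduces the last expectation to a single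
  threshold \<open>p\<close>, where the tail bound \<open>P(X\<^sub>i \<ge> t) \<le> r\<^sub>i / t\<close> and independence leave, in the main case
  \<open>p \<ge> max(r\<^sub>1,r\<^sub>2)\<close>, the quantity \<open>(r\<^sub>1 r\<^sub>2 / p) (ln (p / r\<^sub>1) + ln (p / r\<^sub>2) + 1) \<le> (r\<^sub>1 + r\<^sub>2) / \<surd>e\<close>.
\<close>

section \<open>Tail integrals\<close>

text \<open>The positive part of \<open>f x - a\<close> is the length of \<open>{a<..f x}\<close>,
  and Fubini exchanges the two integrals. The level sets are closed, \<open>t \<le> f x\<close>, to
  match the tail bounds on \<open>{t..}\<close>; \<open>N\<close> is general so that both one law
  and a product of two laws can be inserted.\<close>

lemma nn_integral_pos_part_layer_cake:
  fixes f :: "'b \<Rightarrow> real"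
  assumes "sigma_finite_measure N" and [measurable]: "f \<in> borel_measurable N"
  shows "(\<integral>\<^sup>+x. ennreal (max 0 (f x - a)) \<partial>N) =
         (\<integral>\<^sup>+t. indicator {a<..} t * emeasure N {x \<in> space N. t \<le> f x} \<partial>lborel)"
proof -
  interpret N: sigma_finite_measure N by fact
  interpret pair_sigma_finite N "lborel :: real measure" ..
  have "(\<integral>\<^sup>+x. ennreal (max 0 (f x - a)) \<partial>N) =
        (\<integral>\<^sup>+x. \<integral>\<^sup>+t. indicator {(x, t). a < t \<and> t \<le> f x} (x, t) \<partial>lborel \<partial>N)"
  proof (rule nn_integral_cong)
    fix x
    have "(\<integral>\<^sup>+t. indicator {(x, t). a < t \<and> t \<le> f x} (x, t) \<partial>lborel) =
          (\<integral>\<^sup>+t. indicator {a<..f x} t \<partial>lborel)"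
      by (intro nn_integral_cong) (auto split: split_indicator)
    also have "\<dots> = ennreal (max 0 (f x - a))"
      by (cases "a \<le> f x") (auto simp: max_def)
    finally show "ennreal (max 0 (f x - a)) =
      (\<integral>\<^sup>+t. indicator {(x, t). a < t \<and> t \<le> f x} (x, t) \<partial>lborel)" ..
  qed
  also have "\<dots> = (\<integral>\<^sup>+t. \<integral>\<^sup>+x. indicator {(x, t). a < t \<and> t \<le> f x} (x, t) \<partial>N \<partial>lborel)"
    by (rule Fubini'[symmetric]) measurable
  also have "\<dots> = (\<integral>\<^sup>+t. indicator {a<..} t * emeasure N {x \<in> space N. t \<le> f x} \<partial>lborel)"
  proof (rule nn_integral_cong)
    fix t
    have "(\<integral>\<^sup>+x. indicator {(x, t). a < t \<and> t \<le> f x} (x, t) \<partial>N) =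
       (\<integral>\<^sup>+x. indicator {a<..} t * indicator {x \<in> space N. t \<le> f x} x \<partial>N)"
      by (intro nn_integral_cong) (auto split: split_indicator)
    also have "\<dots> = indicator {a<..} t * emeasure N {x \<in> space N. t \<le> f x}"
      by (subst nn_integral_cmult) auto
    finally show "(\<integral>\<^sup>+x. indicator {(x, t). a < t \<and> t \<le> f x} (x, t) \<partial>N) =
      indicator {a<..} t * emeasure N {x \<in> space N. t \<le> f x}" .
  qed
  finally show ?thesis .
qed

text \<open>On a partition into equal pieces the lower bounds for the increments of \<open>f\<close>
  telescope to \<open>(h a - h b)\<close> times the mesh, which tends to 0. This stands in for
  comparing derivatives: it will be applied with \<open>h\<close> a one-sided slope that may
  jump.\<close>

lemma telescoping_mono:
  fixes f h :: "real \<Rightarrow> real"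
  assumes "a \<le> b"
    and step: "\<And>t t'. a \<le> t \<Longrightarrow> t \<le> t' \<Longrightarrow> t' \<le> b \<Longrightarrow> (h t - h t') * (t' - t) \<le> f t' - f t"
  shows "f a \<le> f b"
proof -
  have bound: "(h a - h b) * (b - a) * (1 / real (Suc n)) \<le> f b - f a" for n
  proof -
    define d where "d = (b - a) / real (Suc n)"
    define t where "t i = a + real i * d" for i
    have d: "0 \<le> d" using assms(1) by (simp add: d_def)
    have tS: "t (Suc i) - t i = d" for i by (simp add: t_def algebra_simps)
    have t0: "t 0 = a" and tn: "t (Suc n) = b" by (simp_all add: t_def d_def field_simps)
    have tle: "t i \<le> t j" if "i \<le> j" for i j
      using that d by (simp add: t_def mult_right_mono)
    have "(h a - h b) * d = (\<Sum>i<Suc n. (h (t i) - h (t (Suc i)))) * d"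
      by (subst sum_lessThan_telescope') (simp only: t0 tn)
    also have "\<dots> = (\<Sum>i<Suc n. (h (t i) - h (t (Suc i))) * (t (Suc i) - t i))"
      by (simp only: tS sum_distrib_right)
    also have "\<dots> \<le> (\<Sum>i<Suc n. f (t (Suc i)) - f (t i))"
    proof (rule sum_mono)
      fix i assume "i \<in> {..<Suc n}"
      then show "(h (t i) - h (t (Suc i))) * (t (Suc i) - t i) \<le> f (t (Suc i)) - f (t i)"
        using tle[of 0 i] tle[of "Suc i" "Suc n"] tle[of i "Suc i"] by (intro step) (simp_all add: t0 tn)
    qed
    also have "\<dots> = f b - f a" by (subst sum_lessThan_telescope) (simp only: t0 tn)
    finally show ?thesis by (simp add: d_def)
  qed
  have "(\<lambda>n. (h a - h b) * (b - a) * (1 / real (Suc n))) \<longlonglongrightarrow> (h a - h b) * (b - a) * 0"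
    using lim_1_over_n LIMSEQ_Suc by (intro tendsto_mult tendsto_const) fastforce
  then have "(h a - h b) * (b - a) * 0 \<le> f b - f a"
    by (rule LIMSEQ_le_const2) (use bound in blast)
  then show ?thesis by simp
qed

text \<open>The tail is at most 1 below \<open>r\<close> and at most \<open>r / t\<close> on
  \<open>{r..w}\<close>; integrating these two pieces gives \<open>r\<close> and the
  logarithm.\<close>

lemma nn_integral_min_le:
  fixes D :: "real measure"
  assumes D: "prob_space D" and [measurable_cong]: "sets D = sets borel"
    and tail: "\<And>t. 0 \<le> t \<Longrightarrow> t * measure D {t..} \<le> r"
    and r: "0 < r" "r \<le> w"
  shows "(\<integral>\<^sup>+x. ennreal (max 0 (min x w)) \<partial>D) \<le> ennreal (r + r * ln (w / r))"
proof -
  interpret prob_space D by fact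
  have sp: "space D = UNIV" using assms(2) sets_eq_imp_space_eq[of D borel] by simp
  have em: "emeasure D {t..} \<le> ennreal (min 1 (r / t))" if "0 < t" for t
    using tail[of t] that prob_le_1[of "{t..}"]
    by (auto simp: emeasure_eq_measure field_simps intro!: ennreal_leI)
  have "(\<integral>\<^sup>+x. ennreal (max 0 (min x w)) \<partial>D) = (\<integral>\<^sup>+x. ennreal (max 0 (min x w - 0)) \<partial>D)" by simp
  also have "\<dots> = (\<integral>\<^sup>+t. indicator {0<..} t * emeasure D {x \<in> space D. t \<le> min x w} \<partial>lborel)"
    by (rule nn_integral_pos_part_layer_cake) (auto intro: sigma_finite_measure_axioms)
  also have "\<dots> \<le> (\<integral>\<^sup>+t. indicator {0<..<r} t + ennreal (r / t) * indicator {r..w} t \<partial>lborel)"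
  proof (rule nn_integral_mono)
    fix t :: real
    have eq: "{x \<in> space D. t \<le> min x w} = (if t \<le> w then {t..} else {})" by (auto simp: sp)
    show "indicator {0<..} t * emeasure D {x \<in> space D. t \<le> min x w}
       \<le> indicator {0<..<r} t + ennreal (r / t) * indicator {r..w} t"
      unfolding eq using em[of t] r
      by (auto split: split_indicator simp: min_def emeasure_le_1 divide_simps intro: order_trans split: if_splits)
  qed
  also have "\<dots> = ennreal r + (\<integral>\<^sup>+t. ennreal (r / t) * indicator {r..w} t \<partial>lborel)"
    using r by (subst nn_integral_add) auto
  also have "(\<integral>\<^sup>+t. ennreal (r / t) * indicator {r..w} t \<partial>lborel) = ennreal (r * ln w - r * ln r)"
    using r by (intro nn_integral_FTC_Icc) (auto intro!: derivative_eq_intros simp: divide_simps)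
  also have "ennreal r + ennreal (r * ln w - r * ln r) = ennreal (r + r * ln (w / r))"
    using r by (subst ennreal_plus[symmetric]) (auto simp: ln_div algebra_simps)
  finally show ?thesis .
qed

text \<open>This is where independence gains a power: under the product measure the minimum exceeds
  \<open>t\<close> with probability at most \<open>r1 * r2 / t\<^sup>2\<close>, which is integrable
  at infinity.\<close>

lemma nn_integral_excess_min_le:
  fixes D E :: "real measure"
  assumes D: "prob_space D" and [measurable_cong]: "sets D = sets borel"
    and E: "prob_space E" and [measurable_cong]: "sets E = sets borel"
    and tail1: "\<And>t. 0 \<le> t \<Longrightarrow> t * measure D {t..} \<le> r1"
    and tail2: "\<And>t. 0 \<le> t \<Longrightarrow> t * measure E {t..} \<le> r2"
    and w: "0 < w" "0 < r1" "0 < r2"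
  shows "(\<integral>\<^sup>+p. ennreal (max 0 (min (fst p) (snd p) - w)) \<partial>(D \<Otimes>\<^sub>M E)) \<le> ennreal (r1 * r2 / w)"
proof -
  interpret D: prob_space D by fact
  interpret E: prob_space E by fact
  interpret pair_prob_space D E ..
  have sp: "space D = UNIV" "space E = UNIV"
    using assms(2,4) sets_eq_imp_space_eq[of D borel] sets_eq_imp_space_eq[of E borel] by simp_all
  have "(\<integral>\<^sup>+p. ennreal (max 0 (min (fst p) (snd p) - w)) \<partial>(D \<Otimes>\<^sub>M E)) =
     (\<integral>\<^sup>+t. indicator {w<..} t * emeasure (D \<Otimes>\<^sub>M E)
        {p \<in> space (D \<Otimes>\<^sub>M E). t \<le> min (fst p) (snd p)} \<partial>lborel)"
    by (rule nn_integral_pos_part_layer_cake) (auto intro: sigma_finite_measure_axioms)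
  also have "\<dots> \<le> (\<integral>\<^sup>+t. ennreal (r1 * r2 / t\<^sup>2) * indicator {w..} t \<partial>lborel)"
  proof (rule nn_integral_mono)
    fix t :: real
    have eq: "{p \<in> space (D \<Otimes>\<^sub>M E). t \<le> min (fst p) (snd p)} = {t..} \<times> {t..}"
      by (auto simp: sp space_pair_measure)
    have "emeasure (D \<Otimes>\<^sub>M E) ({t..} \<times> {t..}) \<le> ennreal (r1 * r2 / t\<^sup>2)" if "0 < t"
    proof -
      have a: "measure D {t..} \<le> r1 / t" "measure E {t..} \<le> r2 / t"
        using tail1[of t] tail2[of t] that by (auto simp: field_simps)
      have "emeasure (D \<Otimes>\<^sub>M E) ({t..} \<times> {t..}) = emeasure D {t..} * emeasure E {t..}"
        by (rule E.emeasure_pair_measure_Times) auto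
      also have "\<dots> = ennreal (measure D {t..} * measure E {t..})"
        by (simp add: D.emeasure_eq_measure E.emeasure_eq_measure ennreal_mult)
      also have "\<dots> \<le> ennreal (r1 / t * (r2 / t))"
        using a w that by (intro ennreal_leI mult_mono) auto
      finally show ?thesis by (simp add: power2_eq_square)
    qed
    then show "indicator {w<..} t * emeasure (D \<Otimes>\<^sub>M E)
        {p \<in> space (D \<Otimes>\<^sub>M E). t \<le> min (fst p) (snd p)} \<le> ennreal (r1 * r2 / t\<^sup>2) * indicator {w..} t"
      unfolding eq using w by (auto split: split_indicator)
  qed
  also have "\<dots> = ennreal (0 - (- (r1 * r2 / w)))"
  proof (rule nn_integral_FTC_atLeast)
    show "((\<lambda>t. - (r1 * r2 / t)) \<longlongrightarrow> 0) at_top"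
      using tendsto_minus[OF tendsto_divide_0[OF tendsto_const[of "r1 * r2"]
          filterlim_at_top_imp_at_infinity[OF filterlim_ident]]] by simp
    show "DERIV (\<lambda>t. - (r1 * r2 / t)) x :> r1 * r2 / x\<^sup>2" if "w \<le> x" for x
      using that w by (auto intro!: derivative_eq_intros simp: power2_eq_square)
  qed (use w in auto)
  finally show ?thesis by simp
qed

text \<open>The optimisation behind the constant. \<open>G1\<close> and \<open>G2\<close> stand for
  the tails of the two laws at the threshold \<open>p\<close>, and \<open>e0\<close>,
  \<open>e1\<close>, \<open>e2\<close> for the expected excess of the minimum over \<open>p\<close>,
  \<open>max p r1\<close>, \<open>max p r2\<close>.\<close>

lemma threshold_value_le:
  fixes r1 r2 p G1 G2 e0 e1 e2 :: real
  assumes r: "0 < r1" "0 < r2" and p: "0 \<le> p"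
    and G: "0 \<le> G1" "G1 \<le> 1" "p * G1 \<le> r1" "0 \<le> G2" "G2 \<le> 1" "p * G2 \<le> r2"
    and e: "e1 \<le> e0" "e2 \<le> e0" "e1 \<le> r1 * r2 / max p r1" "e2 \<le> r1 * r2 / max p r2"
  shows "r1 * ln (max p r1 / r1) * G2 + r2 * ln (max p r2 / r2) * G1 + e1 + e2 - e0
         \<le> (r1 + r2) / sqrt (exp 1)"
proof -
  define c where "c = sqrt (exp (1::real))"
  have c0: "0 < c" by (simp add: c_def)
  have lnc: "ln c = 1/2" by (simp add: c_def ln_sqrt)
  have c2: "c \<le> 2"
    using exp_le by (auto simp: c_def intro!: real_le_lsqrt)
  show ?thesis
  proof (cases "p \<ge> r1 \<and> p \<ge> r2")
    case True
    define g where "g = sqrt (r1 * r2)"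
    have g: "0 < g" "g * g = r1 * r2" using r by (simp_all add: g_def)
    have g2: "2 * g \<le> r1 + r2" using arith_geo_mean_sqrt[of r1 r2] r by (simp add: g_def)
    have p0: "0 < p" using True r by linarith
    \<comment> \<open>As a function of \<open>p\<close>, the expression
      \<open>g * g / p * (2 * ln (p / g) + 1)\<close> is largest at \<open>p = g * c\<close>, so the
      tangent bound for \<open>ln\<close> is taken there and loses nothing at the maximum.\<close>
    have "ln (p / (g * c)) \<le> p / (g * c) - 1" using p0 g c0 by (intro ln_le_minus_one) simp
    then have l: "ln p - ln g - 1/2 \<le> p / (g * c) - 1"
      using p0 g c0 by (simp add: ln_div ln_mult lnc)
    have lg: "2 * ln g = ln r1 + ln r2" using r by (simp add: g_def ln_sqrt ln_mult)
    have "r1 * ln (p / r1) * G2 \<le> r1 * ln (p / r1) * (r2 / p)"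
      using True r G p0 by (intro mult_left_mono) (auto simp: field_simps)
    moreover have "r2 * ln (p / r2) * G1 \<le> r2 * ln (p / r2) * (r1 / p)"
      using True r G p0 by (intro mult_left_mono) (auto simp: field_simps)
    ultimately have "r1 * ln (max p r1 / r1) * G2 + r2 * ln (max p r2 / r2) * G1 + e1 + e2 - e0
      \<le> r1 * ln (p / r1) * (r2 / p) + r2 * ln (p / r2) * (r1 / p) + r1 * r2 / p"
      using e True by (simp add: max_absorb1)
    also have "\<dots> = g * g / p * (2 * (ln p - ln g) + 1)"
      using p0 r lg by (simp add: ln_div g field_simps)
    also have "\<dots> \<le> g * g / p * (2 * p / (g * c))"
    proof (rule mult_left_mono)
      show "2 * (ln p - ln g) + 1 \<le> 2 * p / (g * c)" using l by simp
      show "0 \<le> g * g / p" using p0 by simp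
    qed
    also have "\<dots> = 2 * g / c" using p0 g(1) c0 by simp
    also have "\<dots> \<le> (r1 + r2) / c" using g2 c0 by (simp add: divide_right_mono)
    finally show ?thesis by (simp add: c_def)
  next
    case False
    \<comment> \<open>Here \<open>a\<close> is the smaller and \<open>b\<close> the larger revenue,
      with \<open>p\<close> below \<open>b\<close>: the second logarithm vanishes, \<open>ea\<close>
      cancels against \<open>e0\<close>, and \<open>eb\<close> is at most \<open>a\<close>. What
      remains is at most \<open>b / c + a / 2\<close>, and \<open>c \<le> 2\<close>
      finishes.\<close>
    have key: "a * ln (max p a / a) * H + b * ln (max p b / b) * H' + ea + eb - e0 \<le> (a + b) / c"
      if ab: "0 < a" "a \<le> b" "p < b" "0 \<le> H" "H \<le> 1" "ea \<le> e0" "eb \<le> a * b / max p b" for a b H H' ea eb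
    proof -
      have "ln (b / (a * c)) \<le> b / (a * c) - 1" using ab c0 by (intro ln_le_minus_one) simp
      then have l: "ln (b / a) \<le> b / (a * c) - 1/2"
        using ab c0 by (simp add: ln_div ln_mult lnc)
      have "ln (max p a / a) * H \<le> ln (max p a / a)"
        using ab by (intro mult_left_le) auto
      also have "\<dots> \<le> ln (b / a)"
        using ab by (intro ln_mono divide_right_mono) auto
      finally have "a * (ln (max p a / a) * H) \<le> a * (b / (a * c) - 1/2)"
        using l ab by (intro mult_left_mono) auto
      also have "\<dots> = b / c - a / 2" using ab c0 by (simp add: field_simps)
      finally have "a * ln (max p a / a) * H + b * ln (max p b / b) * H' + ea + eb - e0 \<le> b / c + a / 2"
        using ab by (simp add: max_absorb2)
      also have "\<dots> \<le> b / c + a / c"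
        using ab c0 c2 by (intro add_left_mono divide_left_mono) auto
      finally show ?thesis by (simp add: add_divide_distrib)
    qed
    show ?thesis
    proof (cases "r1 \<le> r2")
      case True
      then show ?thesis using False key[of r1 r2 G2 e1 e2 G1] r G e by (auto simp: c_def)
    next
      case F: False
      then show ?thesis using False key[of r2 r1 G1 e2 e1 G2] r G e by (auto simp: c_def mult.commute add_ac)
    qed
  qed
qed

section \<open>The bound for the diagonal\<close>

lemma AE_pair_fst_snd:
  fixes D E :: "real measure"
  assumes "prob_space D" "prob_space E"
    and [measurable_cong]: "sets D = sets borel" "sets E = sets borel"
    and "AE x in D. 0 \<le> x" "AE y in E. 0 \<le> y"
  shows "AE p in D \<Otimes>\<^sub>M E. 0 \<le> fst p \<and> 0 \<le> snd p"
proof -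
  interpret D: prob_space D by fact
  interpret E: prob_space E by fact
  interpret pair_prob_space D E ..
  show ?thesis
  proof (rule AE_pair_measure)
    show "AE x in D. AE y in E. 0 \<le> fst (x, y) \<and> 0 \<le> snd (x, y)"
      using assms(5) by eventually_elim (use assms(6) in simp)
  qed simp
qed

text \<open>Conditioning on the coordinate \<open>y\<close> with law \<open>E\<close> leaves the
  factor \<open>A y - r\<close>, where \<open>A y\<close> is the mean of the other coordinate
  truncated at \<open>y\<close>. Where this factor is positive, \<open>\<phi>\<close> may be
  replaced by the step function in \<open>thr\<close>, and each step is then estimated by the
  logarithmic bound for truncated means. The 1 in \<open>thr\<close> is the rounding error, paid for
  by the integral of the minimum divided by \<open>n\<close>.\<close>

lemma integral_min_le_thresholds:
  fixes D E :: "real measure" and \<phi> :: "real \<Rightarrow> real" and p :: "'i \<Rightarrow> real" and r :: real and n :: nat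
  assumes E: "prob_space E" and D: "prob_space D"
    and sE[measurable_cong]: "sets E = sets borel" and sD[measurable_cong]: "sets D = sets borel"
    and nnE: "AE y in E. 0 \<le> y" and nnD: "AE x in D. 0 \<le> x"
    and tail: "\<And>t. 0 \<le> t \<Longrightarrow> t * measure D {t..} \<le> r" and r: "0 < r"
    and [measurable]: "\<phi> \<in> borel_measurable borel"
    and \<phi>: "\<And>y. 0 \<le> y \<Longrightarrow> 0 \<le> \<phi> y \<and> \<phi> y \<le> 1"
    and n: "0 < n"
    and thr: "\<And>y. 0 \<le> y \<Longrightarrow> \<phi> y \<le> (1 + (\<Sum>k\<in>K. indicator {p k..} y)) / n"
    and int: "integrable (E \<Otimes>\<^sub>M D) (\<lambda>p. min (fst p) (snd p))"
  shows "(\<integral>q. \<phi> (fst q) * (min (fst q) (snd q) - r) \<partial>(E \<Otimes>\<^sub>M D)) \<le>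
     ((\<integral>q. min (fst q) (snd q) \<partial>(E \<Otimes>\<^sub>M D)) +
      (\<Sum>k\<in>K. r * ln (max (p k) r / r) * measure E {p k..} +
               (\<integral>q. max 0 (min (fst q) (snd q) - max (p k) r) \<partial>(E \<Otimes>\<^sub>M D)))) / n"
proof -
  interpret D: prob_space D by fact
  interpret E: prob_space E by fact
  interpret pair_prob_space E D ..
  define A where "A y = (\<integral>x. min y x \<partial>D)" for y
  \<comment> \<open>The bound for truncated means requires a truncation level of at least
    \<open>r\<close>.\<close>
  define w where "w k = max (p k) r" for k
  define L where "L k = r * ln (w k / r)" for k
  define e where "e k y = (\<integral>x. max 0 (min y x - w k) \<partial>D)" for k y
  note AE = AE_pair_fst_snd[OF E D sE sD nnE nnD]
  have wr: "r \<le> w k" for k by (simp add: w_def)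
  have L0: "0 \<le> L k" for k using wr[of k] r by (simp add: L_def)
  have e0: "0 \<le> e k y" for k y by (simp add: e_def)
  have A0: "0 \<le> A y" if "0 \<le> y" for y
    unfolding A_def by (rule integral_nonneg_AE) (use nnD that in \<open>auto elim: eventually_mono\<close>)
  \<comment> \<open>Truncation at \<open>y\<close> makes the integrand bounded almost everywhere, so
    an infinite mean of \<open>D\<close> does no harm.\<close>
  have intA: "integrable D (\<lambda>x. min y x)" for y
  proof (rule D.integrable_const_bound[where B = "\<bar>y\<bar>"])
    show "AE x in D. norm (min y x) \<le> \<bar>y\<bar>"
      using nnD by eventually_elim (auto simp: min_def)
  qed measurable
  have inte: "integrable D (\<lambda>x. max 0 (min y x - w k))" for y k
    by (intro integrable_max) (auto intro: intA)
  have int_e: "integrable (E \<Otimes>\<^sub>M D) (\<lambda>q. max 0 (min (fst q) (snd q) - w k))" for k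
    by (intro integrable_max) (auto intro: int)
  have Aw: "A (w k) \<le> r + L k" for k
  proof -
    have "ennreal (A (w k)) = (\<integral>\<^sup>+x. ennreal (min (w k) x) \<partial>D)"
      unfolding A_def
      by (rule nn_integral_eq_integral[symmetric, OF intA])
         (use nnD wr[of k] r in \<open>auto elim: eventually_mono\<close>)
    also have "\<dots> \<le> (\<integral>\<^sup>+x. ennreal (max 0 (min x (w k))) \<partial>D)"
      by (intro nn_integral_mono ennreal_leI) auto
    also have "\<dots> \<le> ennreal (r + r * ln (w k / r))"
      by (rule nn_integral_min_le[OF D sD tail r wr])
    finally show ?thesis
      using r L0[of k] by (subst (asm) ennreal_le_iff) (auto simp: L_def)
  qed
  have A_le: "A y \<le> r + L k + e k y" for k y
  proof -
    \<comment> \<open>The truncation at \<open>y\<close> is split at the level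
      \<open>w k\<close>.\<close>
    have "A y \<le> (\<integral>x. min (w k) x + max 0 (min y x - w k) \<partial>D)"
      unfolding A_def by (intro integral_mono intA Bochner_Integration.integrable_add inte) auto
    also have "\<dots> = A (w k) + e k y"
      unfolding A_def e_def by (intro Bochner_Integration.integral_add intA inte)
    finally show ?thesis using Aw[of k] by simp
  qed
  \<comment> \<open>The term \<open>e k y\<close> carries no indicator because it already vanishes
    for \<open>y < p k\<close>, where \<open>min y x\<close> stays below \<open>w k\<close>.\<close>
  define h where "h y = (A y + (\<Sum>k\<in>K. L k * indicator {p k..} y + e k y)) / n" for y
  have pt: "\<phi> y * (A y - r) \<le> h y" if y: "0 \<le> y" for y
  proof -
    have s: "0 \<le> (\<Sum>k\<in>K. L k * indicator {p k..} y + e k y)"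
      by (intro sum_nonneg add_nonneg_nonneg mult_nonneg_nonneg L0 e0) auto
    show ?thesis
    proof (cases "A y \<le> r")
      case True
      then have "\<phi> y * (A y - r) \<le> 0" using \<phi>[OF y] by (intro mult_nonneg_nonpos) auto
      also have "0 \<le> h y" unfolding h_def using A0[OF y] s by simp
      finally show ?thesis .
    next
      case False
      have "\<phi> y * (A y - r) \<le> (1 + (\<Sum>k\<in>K. indicator {p k..} y)) / n * (A y - r)"
        using False thr[OF y] by (intro mult_right_mono) auto
      also have "\<dots> = ((A y - r) + (\<Sum>k\<in>K. indicator {p k..} y * (A y - r))) / n"
        by (simp only: sum_distrib_right[symmetric]) (simp add: distrib_right)
      also have "\<dots> \<le> h y"
        unfolding h_def
      proof (intro divide_right_mono add_mono sum_mono)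
        fix k
        show "indicator {p k..} y * (A y - r) \<le> L k * indicator {p k..} y + e k y"
          using A_le[of y k] e0[of k y] by (auto split: split_indicator)
      qed (use r in auto)
      finally show ?thesis .
    qed
  qed
  have int1: "integrable (E \<Otimes>\<^sub>M D) (\<lambda>q. \<phi> (fst q) * (min (fst q) (snd q) - r))"
  proof (rule Bochner_Integration.integrable_bound)
    show "integrable (E \<Otimes>\<^sub>M D) (\<lambda>q. min (fst q) (snd q) - r)" using int by simp
    show "AE q in E \<Otimes>\<^sub>M D. norm (\<phi> (fst q) * (min (fst q) (snd q) - r)) \<le> norm (min (fst q) (snd q) - r)"
      using AE
    proof eventually_elim
      case (elim q)
      then show ?case using \<phi>[of "fst q"]
        by (auto simp: abs_mult intro!: mult_left_le_one_le)
    qed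
  qed measurable
  have int_A: "integrable E A" and eqA: "(\<integral>y. A y \<partial>E) = (\<integral>q. min (fst q) (snd q) \<partial>(E \<Otimes>\<^sub>M D))"
    using integrable_fst'[OF int] integral_fst'[OF int] by (simp_all add: A_def[abs_def])
  have int_ek: "integrable E (e k)" and eqe: "(\<integral>y. e k y \<partial>E) = (\<integral>q. max 0 (min (fst q) (snd q) - w k) \<partial>(E \<Otimes>\<^sub>M D))" for k
    using integrable_fst'[OF int_e] integral_fst'[OF int_e] by (simp_all add: e_def[abs_def])
  have int_i: "integrable E (\<lambda>y. L k * indicator {p k..} y)" for k
    by (intro integrable_mult_right integrable_real_indicator) (auto simp: E.emeasure_eq_measure)
  have sp: "space E = UNIV" using sE sets_eq_imp_space_eq[of E borel] by simp
  have "(\<integral>q. \<phi> (fst q) * (min (fst q) (snd q) - r) \<partial>(E \<Otimes>\<^sub>M D)) =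
        (\<integral>y. \<integral>x. \<phi> y * (min y x - r) \<partial>D \<partial>E)"
    using integral_fst'[OF int1] by simp
  also have "\<dots> = (\<integral>y. \<phi> y * (A y - r) \<partial>E)"
    using intA by (simp add: A_def D.prob_space)
  also have "\<dots> \<le> (\<integral>y. h y \<partial>E)"
  proof (rule integral_mono_AE)
    show "integrable E (\<lambda>y. \<phi> y * (A y - r))"
      using integrable_fst'[OF int1] intA by (simp add: A_def D.prob_space)
    show "integrable E h" unfolding h_def
      by (intro integrable_divide Bochner_Integration.integrable_add Bochner_Integration.integrable_sum int_A int_i int_ek)
    show "AE y in E. \<phi> y * (A y - r) \<le> h y" using nnE by eventually_elim (rule pt)
  qed
  also have "\<dots> = ((\<integral>y. A y \<partial>E) + (\<Sum>k\<in>K. L k * measure E {p k..} + (\<integral>y. e k y \<partial>E))) / n"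
    unfolding h_def using int_A int_i int_ek
    by (simp add: Bochner_Integration.integral_add Bochner_Integration.integral_sum
        Bochner_Integration.integrable_sum Bochner_Integration.integrable_add sp)
  finally show ?thesis by (simp add: eqA eqe L_def w_def)
qed

text \<open>The \<open>p k\<close> are the points where \<open>m\<close> reaches \<open>k / n\<close>; levels that \<open>m\<close> never attains are left out of \<open>K\<close>.\<close>

lemma monotone_thresholds:
  fixes m :: "real \<Rightarrow> real" and n :: nat
  assumes mono: "\<And>x y. 0 \<le> x \<Longrightarrow> x \<le> y \<Longrightarrow> m x \<le> m y"
    and m01: "\<And>x. 0 \<le> x \<Longrightarrow> 0 \<le> m x \<and> m x \<le> 1" and n: "0 < n"
  shows "\<exists>(K :: nat set) p. finite K \<and> card K \<le> n \<and> (\<forall>k\<in>K. 0 \<le> p k) \<and>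
    (\<forall>y\<ge>0. n * m y - 1 \<le> (\<Sum>k\<in>K. indicator {p k..} y)) \<and>
    (\<forall>y\<ge>0. card {k \<in> K. p k < y} \<le> n * m y)"
proof (intro exI conjI ballI allI impI)
  define U where "U k = {t. 0 \<le> t \<and> real k \<le> n * m t}" for k :: nat
  define K where "K = {k \<in> {1..n}. U k \<noteq> {}}"
  define p where "p k = Inf (U k)" for k
  \<comment> \<open>The number of levels \<open>k / n\<close> reached at \<open>y\<close>; rounding
    down accounts for the \<open>- 1\<close> in the lower estimate.\<close>
  define j where "j y = nat \<lfloor>n * m y\<rfloor>" for y
  have bdd: "bdd_below (U k)" for k unfolding U_def by (rule bdd_belowI[of _ 0]) auto
  have j: "j y \<le> n * m y" "n * m y - 1 \<le> j y" if "0 \<le> y" for y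
    using m01[OF that] by (auto simp: j_def)
  show "finite K" by (simp add: K_def)
  have "card K \<le> card {1..n}" unfolding K_def by (intro card_mono) auto
  then show "card K \<le> n" by simp
  show "0 \<le> p k" if "k \<in> K" for k
    using that unfolding p_def K_def by (intro cInf_greatest) (auto simp: U_def)
  show "n * m y - 1 \<le> (\<Sum>k\<in>K. indicator {p k..} y)" if y: "0 \<le> y" for y
  proof -
    have jn: "j y \<le> n"
    proof -
      have "n * m y \<le> n" using m01[OF y] by (simp add: mult_left_le)
      then show ?thesis using j(1)[OF y] by linarith
    qed
    have sub: "k \<in> K \<and> p k \<le> y" if "k \<in> {1..j y}" for k
    proof -
      have "real k \<le> n * m y" using that j(1)[OF y] by (auto intro: order_trans[of _ "real (j y)"])
      then have "y \<in> U k" using y by (simp add: U_def)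
      then show ?thesis using that jn bdd by (auto simp: K_def p_def intro: cInf_lower)
    qed
    have "n * m y - 1 \<le> (\<Sum>k\<in>{1..j y}. 1)" using j(2)[OF y] by simp
    also have "\<dots> = (\<Sum>k\<in>{1..j y}. indicator {p k..} y)"
      by (rule sum.cong) (use sub in auto)
    also have "\<dots> \<le> (\<Sum>k\<in>K. indicator {p k..} y)"
      using sub \<open>finite K\<close> by (intro sum_mono2) auto
    finally show ?thesis .
  qed
  \<comment> \<open>The inequality \<open>p k < y\<close> is strict since the infimum
    \<open>p k\<close> may not be attained: level \<open>k\<close> is certain to be reached only to
    the right of \<open>p k\<close>.\<close>
  show "card {k \<in> K. p k < y} \<le> n * m y" if y: "0 \<le> y" for y
  proof -
    have "{k \<in> K. p k < y} \<subseteq> {1..j y}"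
    proof
      fix k assume k: "k \<in> {k \<in> K. p k < y}"
      then have "Inf (U k) < y" "U k \<noteq> {}" by (auto simp: K_def p_def)
      then obtain t where t: "t \<in> U k" "t < y" using cInf_lessD by blast
      then have "real k \<le> n * m t" "m t \<le> m y" using mono[of t y] by (auto simp: U_def)
      then have "real k \<le> n * m y" by (meson mult_left_mono of_nat_0_le_iff order_trans)
      then have "k \<le> j y" unfolding j_def by linarith
      then show "k \<in> {1..j y}" using k by (auto simp: K_def)
    qed
    then have "card {k \<in> K. p k < y} \<le> card {1..j y}" by (intro card_mono) auto
    then show ?thesis using j(1)[OF y] by simp
  qed
qed

text \<open>The left side is a convex piecewise linear function of \<open>z\<close> whose slope, the
  proportion of thresholds already passed, is at most \<open>m\<close>, while \<open>m\<close>
  bounds the slope of \<open>\<beta>\<close> from below. The difference therefore satisfies the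
  increment condition of \<open>telescoping_mono\<close> with \<open>h = m\<close>.\<close>

lemma sum_thresholds_le_potential:
  fixes m \<beta> :: "real \<Rightarrow> real" and p :: "nat \<Rightarrow> real" and n :: nat
  assumes "finite K" and p0: "\<And>k. k \<in> K \<Longrightarrow> 0 \<le> p k" and n: "0 < n"
    and cnt: "\<And>y. 0 \<le> y \<Longrightarrow> card {k \<in> K. p k < y} \<le> n * m y"
    and sub: "\<And>t t'. 0 \<le> t \<Longrightarrow> t \<le> t' \<Longrightarrow> m t * (t' - t) \<le> \<beta> t' - \<beta> t"
    and "\<beta> 0 = 0" "0 \<le> z"
  shows "(\<Sum>k\<in>K. max 0 (z - p k)) / n \<le> \<beta> z"
proof -
  define f where "f t = \<beta> t - (\<Sum>k\<in>K. max 0 (t - p k)) / n" for t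
  have "f 0 \<le> f z"
  proof (rule telescoping_mono[OF \<open>0 \<le> z\<close>])
    fix t t' :: real assume t: "0 \<le> t" "t \<le> t'"
    have "(\<Sum>k\<in>K. max 0 (t' - p k)) - (\<Sum>k\<in>K. max 0 (t - p k))
        = (\<Sum>k\<in>K. max 0 (t' - p k) - max 0 (t - p k))" by (simp add: sum_subtractf)
    also have "\<dots> \<le> (\<Sum>k\<in>K. if p k < t' then t' - t else 0)"
      using t by (intro sum_mono) (auto simp: max_def)
    also have "\<dots> = card {k \<in> K. p k < t'} * (t' - t)"
      using \<open>finite K\<close> by (simp add: sum.If_cases Int_def)
    also have "\<dots> \<le> n * m t' * (t' - t)"
      using cnt[of t'] t by (intro mult_right_mono) auto
    finally have "((\<Sum>k\<in>K. max 0 (t' - p k)) - (\<Sum>k\<in>K. max 0 (t - p k))) / n \<le> m t' * (t' - t)"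
      using n by (simp add: field_simps)
    then show "(m t - m t') * (t' - t) \<le> f t' - f t"
      using sub[OF t] by (simp add: f_def algebra_simps diff_divide_distrib)
  qed
  moreover have "(\<Sum>k\<in>K. max 0 (0 - p k)) = 0" by (rule sum.neutral) (use p0 in auto)
  then have "f 0 = 0" using \<open>\<beta> 0 = 0\<close> by (simp add: f_def)
  ultimately show ?thesis by (simp add: f_def)
qed

text \<open>A tail of order \<open>r / t\<close> allows an infinite mean, so the coordinates
  themselves may fail to be integrable. Their minimum is at most 1 plus its excess over 1, and that
  excess has a finite integral.\<close>

lemma
  fixes D E :: "real measure"
  assumes D: "prob_space D" and sD[measurable_cong]: "sets D = sets borel"
    and E: "prob_space E" and sE[measurable_cong]: "sets E = sets borel"
    and nnD: "AE x in D. 0 \<le> x" and nnE: "AE x in E. 0 \<le> x"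
    and tail1: "\<And>t. 0 \<le> t \<Longrightarrow> t * measure D {t..} \<le> r1"
    and tail2: "\<And>t. 0 \<le> t \<Longrightarrow> t * measure E {t..} \<le> r2"
    and r: "0 < r1" "0 < r2"
  shows integrable_min: "integrable (D \<Otimes>\<^sub>M E) (\<lambda>q. min (fst q) (snd q))"
    and integral_excess_min_le: "0 < w \<Longrightarrow> (\<integral>q. max 0 (min (fst q) (snd q) - w) \<partial>(D \<Otimes>\<^sub>M E)) \<le> r1 * r2 / w"
proof -
  interpret D: prob_space D by fact
  interpret E: prob_space E by fact
  interpret pair_prob_space D E ..
  note AE = AE_pair_fst_snd[OF D E sD sE nnD nnE]
  have nn: "(\<integral>\<^sup>+q. ennreal (max 0 (min (fst q) (snd q) - w)) \<partial>(D \<Otimes>\<^sub>M E)) \<le> ennreal (r1 * r2 / w)"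
    if "0 < w" for w
    by (rule nn_integral_excess_min_le[OF D sD E sE tail1 tail2 that r])
  have intw: "integrable (D \<Otimes>\<^sub>M E) (\<lambda>q. max 0 (min (fst q) (snd q) - w))" if "0 < w" for w
    by (rule integrableI_nonneg) (use nn[OF that] in \<open>auto simp: le_less_trans\<close>)
  show "integrable (D \<Otimes>\<^sub>M E) (\<lambda>q. min (fst q) (snd q))"
  proof (rule Bochner_Integration.integrable_bound)
    show "integrable (D \<Otimes>\<^sub>M E) (\<lambda>q. 1 + max 0 (min (fst q) (snd q) - 1))"
      using intw[of 1] by simp
    show "AE q in D \<Otimes>\<^sub>M E. norm (min (fst q) (snd q)) \<le> norm (1 + max 0 (min (fst q) (snd q) - 1))"
      using AE by eventually_elim auto
  qed measurable
  assume w: "0 < w"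
  have "ennreal (\<integral>q. max 0 (min (fst q) (snd q) - w) \<partial>(D \<Otimes>\<^sub>M E)) \<le> ennreal (r1 * r2 / w)"
    by (subst nn_integral_eq_integral[symmetric]) (use nn[OF w] intw[OF w] in auto)
  then show "(\<integral>q. max 0 (min (fst q) (snd q) - w) \<partial>(D \<Otimes>\<^sub>M E)) \<le> r1 * r2 / w"
    using w r by (subst (asm) ennreal_le_iff) auto
qed

text \<open>One family of thresholds, built from \<open>m\<close>, serves \<open>\<phi>\<close>,
  \<open>\<psi>\<close> and \<open>\<beta>\<close> at once, so that the comparison can be made
  threshold by threshold. With \<open>n\<close> levels the rounding costs \<open>2 * Z / n\<close>,
  which disappears in the limit.\<close>

lemma
  fixes D1 D2 :: "real measure" and \<phi> \<psi> \<beta> :: "real \<Rightarrow> real"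
  assumes D1: "prob_space D1" and D2: "prob_space D2"
    and s1[measurable_cong]: "sets D1 = sets borel" and s2[measurable_cong]: "sets D2 = sets borel"
    and nn1: "AE x in D1. 0 \<le> x" and nn2: "AE x in D2. 0 \<le> x"
    and tail1: "\<And>t. 0 \<le> t \<Longrightarrow> t * measure D1 {t..} \<le> r1"
    and tail2: "\<And>t. 0 \<le> t \<Longrightarrow> t * measure D2 {t..} \<le> r2"
    and r: "0 < r1" "0 < r2"
    and [measurable]: "\<phi> \<in> borel_measurable borel" "\<psi> \<in> borel_measurable borel" "\<beta> \<in> borel_measurable borel"
    and \<phi>: "\<And>y. 0 \<le> y \<Longrightarrow> 0 \<le> \<phi> y \<and> \<phi> y \<le> 1"
    and \<psi>: "\<And>y. 0 \<le> y \<Longrightarrow> 0 \<le> \<psi> y \<and> \<psi> y \<le> 1"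
    and sub: "\<And>t t'. 0 \<le> t \<Longrightarrow> 0 \<le> t' \<Longrightarrow> (\<phi> t + \<psi> t) * (t' - t) \<le> \<beta> t' - \<beta> t"
    and \<beta>0: "\<beta> 0 = 0"
  defines "z q \<equiv> min (fst q) (snd q)"
  shows integrable_potential_min: "integrable (D1 \<Otimes>\<^sub>M D2) (\<lambda>q. \<beta> (z q))"
    and diagonal_bound: "(\<integral>q. \<phi> (snd q) * (z q - r1) \<partial>(D1 \<Otimes>\<^sub>M D2)) + (\<integral>q. \<psi> (fst q) * (z q - r2) \<partial>(D1 \<Otimes>\<^sub>M D2))
     \<le> (\<integral>q. \<beta> (z q) \<partial>(D1 \<Otimes>\<^sub>M D2)) + (r1 + r2) / sqrt (exp 1)"
proof -
  interpret D1: prob_space D1 by fact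
  interpret D2: prob_space D2 by fact
  interpret P: pair_prob_space D1 D2 ..
  define P where "P = D1 \<Otimes>\<^sub>M D2"
  have sP[measurable_cong]: "sets P = sets (borel \<Otimes>\<^sub>M borel)"
    unfolding P_def by (intro sets_pair_measure_cong s1 s2)
  have [measurable]: "z \<in> borel_measurable P" by (simp add: z_def[abs_def])
  note AE = AE_pair_fst_snd[OF D1 D2 s1 s2 nn1 nn2, folded P_def]
  have int: "integrable P z"
    using integrable_min[OF D1 s1 D2 s2 nn1 nn2 tail1 tail2 r] by (simp add: z_def[abs_def] P_def)
  have intw: "integrable P (\<lambda>q. max 0 (z q - w))" for w
  proof (intro integrable_max Bochner_Integration.integrable_diff int)
    show "integrable P (\<lambda>_. w)" by (simp add: P_def)
  qed simp
  define e where "e w = (\<integral>q. max 0 (z q - w) \<partial>P)" for w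
  have ew: "e w \<le> r1 * r2 / w" if "0 < w" for w
    unfolding e_def z_def P_def
    by (rule integral_excess_min_le[OF D1 s1 D2 s2 nn1 nn2 tail1 tail2 r that])
  have emono: "e w' \<le> e w" if "w \<le> w'" for w w'
    unfolding e_def by (intro integral_mono intw) (use that in auto)
  define Z where "Z = (\<integral>q. z q \<partial>P)"
  \<comment> \<open>\<open>\<phi>\<close> depends on the second coordinate, so the threshold
    estimate for it is applied with the factors exchanged.\<close>
  have swap: "(\<integral>q. f (snd q) (fst q) \<partial>(D2 \<Otimes>\<^sub>M D1)) = (\<integral>q. f (fst q) (snd q) \<partial>P)"
    if [measurable]: "(\<lambda>q. f (fst q) (snd q)) \<in> borel_measurable P" for f :: "real \<Rightarrow> real \<Rightarrow> real"
    using P.integral_product_swap[of "\<lambda>q. f (fst q) (snd q)"] that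
    by (simp add: P_def case_prod_unfold)
  \<comment> \<open>The cap at 1 keeps the number of thresholds at most \<open>n\<close>; the sum
    itself could reach 2 and double the bound. Since \<open>\<phi>\<close> and \<open>\<psi>\<close>
    are at most 1, the capped sum still dominates both.\<close>
  define m where "m t = min 1 (\<phi> t + \<psi> t)" for t
  \<comment> \<open>Adding \<open>sub\<close> in both directions cancels \<open>\<beta>\<close>.
    Along the diagonal only the sum is known to be monotone: one allocation may fall while the other
    rises.\<close>
  have \<gamma>mono: "\<phi> x + \<psi> x \<le> \<phi> y + \<psi> y" if "0 \<le> x" "x \<le> y" for x y
  proof (cases "x = y")
    case False
    have "(\<phi> x + \<psi> x) * (y - x) \<le> (\<phi> y + \<psi> y) * (y - x)"
      using sub[of x y] sub[of y x] that by (simp add: algebra_simps)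
    then show ?thesis using False that by (simp add: mult_le_cancel_right)
  qed simp
  have mmono: "m x \<le> m y" if "0 \<le> x" "x \<le> y" for x y using \<gamma>mono[OF that] by (auto simp: m_def)
  have m01: "0 \<le> m y \<and> m y \<le> 1" if "0 \<le> y" for y using \<phi>[OF that] \<psi>[OF that] by (auto simp: m_def)
  have msub: "m t * (t' - t) \<le> \<beta> t' - \<beta> t" if "0 \<le> t" "t \<le> t'" for t t'
  proof -
    have "m t * (t' - t) \<le> (\<phi> t + \<psi> t) * (t' - t)"
      using that by (intro mult_right_mono) (auto simp: m_def)
    then show ?thesis using sub[of t t'] that by simp
  qed
  have int\<beta>: "integrable P (\<lambda>q. \<beta> (z q))"
  proof (rule Bochner_Integration.integrable_bound)
    show "integrable P (\<lambda>q. 2 * z q)" using int by simp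
    show "AE q in P. norm (\<beta> (z q)) \<le> norm (2 * z q)"
      using AE
    proof eventually_elim
      case (elim q)
      then have z: "0 \<le> z q" by (simp add: z_def)
      have "0 \<le> \<beta> (z q)" using msub[of 0 "z q"] m01[of 0] z \<beta>0
        by (metis diff_zero mult_nonneg_nonneg order_refl order_trans)
      \<comment> \<open>This is \<open>sub\<close> at \<open>z q\<close> compared with the
        origin.\<close>
      moreover have "\<beta> (z q) \<le> (\<phi> (z q) + \<psi> (z q)) * z q" using sub[of "z q" 0] z \<beta>0 by simp
      moreover have "(\<phi> (z q) + \<psi> (z q)) * z q \<le> 2 * z q"
        using \<phi>[OF z] \<psi>[OF z] z by (intro mult_right_mono) auto
      ultimately show ?case using z by simp
    qed
  qed measurable
  then show "integrable (D1 \<Otimes>\<^sub>M D2) (\<lambda>q. \<beta> (z q))" by (simp add: P_def)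
  let ?I\<phi> = "\<integral>q. \<phi> (snd q) * (z q - r1) \<partial>P" and ?I\<psi> = "\<integral>q. \<psi> (fst q) * (z q - r2) \<partial>P"
    and ?I\<beta> = "\<integral>q. \<beta> (z q) \<partial>P"
  have main: "?I\<phi> + ?I\<psi> - ?I\<beta> \<le> 2 * Z * (1 / real n) + (r1 + r2) / sqrt (exp 1)" if n: "0 < n" for n :: nat
  proof -
    obtain K :: "nat set" and p where K: "finite K" "card K \<le> n" and p0: "\<And>k. k \<in> K \<Longrightarrow> 0 \<le> p k"
      and lo: "\<And>y. 0 \<le> y \<Longrightarrow> n * m y - 1 \<le> (\<Sum>k\<in>K. indicator {p k..} y)"
      and up: "\<And>y. 0 \<le> y \<Longrightarrow> card {k \<in> K. p k < y} \<le> n * m y"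
      using monotone_thresholds[of m n, OF mmono m01 n] by blast
    have thr: "f y \<le> (1 + (\<Sum>k\<in>K. indicator {p k..} y)) / n" if "0 \<le> y" "f y \<le> m y" for f y
    proof -
      have "n * f y \<le> n * m y" using that(2) by (intro mult_left_mono) auto
      then have "n * f y \<le> 1 + (\<Sum>k\<in>K. indicator {p k..} y)"
        using lo[OF that(1)] by linarith
      then show ?thesis using n by (simp add: pos_le_divide_eq mult.commute)
    qed
    have \<phi>m: "\<phi> y \<le> m y" and \<psi>m: "\<psi> y \<le> m y" if "0 \<le> y" for y
      using \<phi>[OF that] \<psi>[OF that] by (auto simp: m_def)
    have zc: "min (snd q) (fst q) = z q" for q by (simp add: z_def min.commute)
    have "?I\<phi> = (\<integral>q. \<phi> (fst q) * (min (fst q) (snd q) - r1) \<partial>(D2 \<Otimes>\<^sub>M D1))"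
      using swap[of "\<lambda>x y. \<phi> y * (min y x - r1)"] by (simp add: zc)
    also have "\<dots> \<le> ((\<integral>q. min (fst q) (snd q) \<partial>(D2 \<Otimes>\<^sub>M D1)) +
      (\<Sum>k\<in>K. r1 * ln (max (p k) r1 / r1) * measure D2 {p k..} +
               (\<integral>q. max 0 (min (fst q) (snd q) - max (p k) r1) \<partial>(D2 \<Otimes>\<^sub>M D1)))) / n"
    proof (rule integral_min_le_thresholds[OF D2 D1 s2 s1 nn2 nn1 tail1 r(1) _ \<phi> n thr])
      show "integrable (D2 \<Otimes>\<^sub>M D1) (\<lambda>q. min (fst q) (snd q))"
        by (rule integrable_min[OF D2 s2 D1 s1 nn2 nn1 tail2 tail1 r(2,1)])
    qed (use \<phi>m in auto)
    also have "(\<integral>q. min (fst q) (snd q) \<partial>(D2 \<Otimes>\<^sub>M D1)) = Z"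
      using swap[of "\<lambda>x y. min y x"] by (simp add: zc Z_def)
    also have "(\<lambda>k. (\<integral>q. max 0 (min (fst q) (snd q) - max (p k) r1) \<partial>(D2 \<Otimes>\<^sub>M D1))) = (\<lambda>k. e (max (p k) r1))"
    proof
      fix k
      show "(\<integral>q. max 0 (min (fst q) (snd q) - max (p k) r1) \<partial>(D2 \<Otimes>\<^sub>M D1)) = e (max (p k) r1)"
        using swap[of "\<lambda>x y. max 0 (min y x - max (p k) r1)"] by (simp add: zc e_def)
    qed
    finally have A: "?I\<phi> \<le> (Z + (\<Sum>k\<in>K. r1 * ln (max (p k) r1 / r1) * measure D2 {p k..} + e (max (p k) r1))) / n" .
    have B: "?I\<psi> \<le> (Z + (\<Sum>k\<in>K. r2 * ln (max (p k) r2 / r2) * measure D1 {p k..} + e (max (p k) r2))) / n"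
      unfolding Z_def e_def z_def P_def
    proof (rule integral_min_le_thresholds[OF D1 D2 s1 s2 nn1 nn2 tail2 r(2) _ \<psi> n thr])
      show "integrable (D1 \<Otimes>\<^sub>M D2) (\<lambda>q. min (fst q) (snd q))"
        using int by (simp add: P_def z_def[abs_def])
    qed (use \<psi>m in auto)
    have C: "(\<Sum>k\<in>K. e (p k)) / n \<le> ?I\<beta>"
    proof -
      have "(\<Sum>k\<in>K. e (p k)) / n = (\<integral>q. (\<Sum>k\<in>K. max 0 (z q - p k)) / n \<partial>P)"
        unfolding e_def using intw by (simp add: Bochner_Integration.integral_sum)
      also have "\<dots> \<le> ?I\<beta>"
      proof (rule integral_mono_AE)
        show "integrable P (\<lambda>q. (\<Sum>k\<in>K. max 0 (z q - p k)) / n)"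
          by (intro integrable_divide Bochner_Integration.integrable_sum intw)
        show "AE q in P. (\<Sum>k\<in>K. max 0 (z q - p k)) / n \<le> \<beta> (z q)"
          using AE
          by eventually_elim (rule sum_thresholds_le_potential[OF K(1) p0 n up msub \<beta>0], auto simp: z_def)
      qed (rule int\<beta>)
      finally show ?thesis .
    qed
    define c where "c = (r1 + r2) / sqrt (exp 1)"
    have F: "r1 * ln (max (p k) r1 / r1) * measure D2 {p k..} + r2 * ln (max (p k) r2 / r2) * measure D1 {p k..}
        + e (max (p k) r1) + e (max (p k) r2) - e (p k) \<le> c" if "k \<in> K" for k
      unfolding c_def using p0[OF that] r tail1[of "p k"] tail2[of "p k"]
      by (intro threshold_value_le emono ew) auto
    have "?I\<phi> + ?I\<psi> - ?I\<beta> \<le> (2 * Z + (\<Sum>k\<in>K. r1 * ln (max (p k) r1 / r1) * measure D2 {p k..} + r2 * ln (max (p k) r2 / r2) * measure D1 {p k..}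
        + e (max (p k) r1) + e (max (p k) r2) - e (p k))) / n"
      using A B C by (simp add: sum.distrib sum_subtractf add_divide_distrib diff_divide_distrib)
    also have "\<dots> \<le> (2 * Z + n * c) / n"
    proof (intro divide_right_mono add_left_mono)
      \<comment> \<open>\<open>K\<close> may have fewer than \<open>n\<close> elements, so enlarging
        its cardinality to \<open>n\<close> uses the sign of \<open>c\<close>.\<close>
      have c0: "0 \<le> c" using r by (simp add: c_def)
      have "(\<Sum>k\<in>K. r1 * ln (max (p k) r1 / r1) * measure D2 {p k..} + r2 * ln (max (p k) r2 / r2) * measure D1 {p k..}
        + e (max (p k) r1) + e (max (p k) r2) - e (p k)) \<le> (\<Sum>k\<in>K. c)" by (rule sum_mono) (rule F)
      also have "\<dots> \<le> n * c" using K(2) c0 by (simp add: mult_right_mono)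
      finally show "(\<Sum>k\<in>K. r1 * ln (max (p k) r1 / r1) * measure D2 {p k..} + r2 * ln (max (p k) r2 / r2) * measure D1 {p k..}
        + e (max (p k) r1) + e (max (p k) r2) - e (p k)) \<le> n * c" .
    qed simp
    also have "\<dots> = 2 * Z * (1 / real n) + c" using n by (simp add: field_simps)
    finally show ?thesis by (simp add: c_def)
  qed
  have "(\<lambda>n. 2 * Z * (1 / real n) + (r1 + r2) / sqrt (exp 1)) \<longlonglongrightarrow> 2 * Z * 0 + (r1 + r2) / sqrt (exp 1)"
    by (intro tendsto_add tendsto_mult tendsto_const lim_1_over_n)
  then have "?I\<phi> + ?I\<psi> - ?I\<beta> \<le> 2 * Z * 0 + (r1 + r2) / sqrt (exp 1)"
    by (rule LIMSEQ_le_const) (use main in \<open>auto intro!: exI[of _ 1]\<close>)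
  then show "(\<integral>q. \<phi> (snd q) * (z q - r1) \<partial>(D1 \<Otimes>\<^sub>M D2)) + (\<integral>q. \<psi> (fst q) * (z q - r2) \<partial>(D1 \<Otimes>\<^sub>M D2))
     \<le> (\<integral>q. \<beta> (z q) \<partial>(D1 \<Otimes>\<^sub>M D2)) + (r1 + r2) / sqrt (exp 1)" by (simp add: P_def)
qed

section \<open>Reduction to the diagonal\<close>

text \<open>Payments are required to be nonnegative on nonnegative values, so that \<^const>\<open>ennreal\<close> truncates nothing.\<close>

definition one_good_mech :: "(real \<Rightarrow> real) \<Rightarrow> (real \<Rightarrow> real) \<Rightarrow> bool" where
  "one_good_mech q s \<longleftrightarrow> q \<in> borel_measurable borel \<and> s \<in> borel_measurable borel \<and>
     (\<forall>x\<ge>0. 0 \<le> q x \<and> q x \<le> 1 \<and> 0 \<le> s x \<and> s x \<le> q x * x) \<and>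
     (\<forall>x\<ge>0. \<forall>x'\<ge>0. q x' * x - s x' \<le> q x * x - s x)"

text \<open>Posting the price \<open>p\<close> is a one-good mechanism, with revenue
  \<open>p * measure D {p..}\<close>.\<close>

lemma tail_le_if_one_good_bound:
  fixes D :: "real measure"
  assumes "prob_space D" and [measurable_cong]: "sets D = sets borel"
    and rev: "\<And>q s. one_good_mech q s \<Longrightarrow> (\<integral>\<^sup>+x. ennreal (s x) \<partial>D) \<le> ennreal r"
    and "0 \<le> r" "0 \<le> p"
  shows "p * measure D {p..} \<le> r"
proof -
  interpret prob_space D by fact
  have "one_good_mech (indicator {p..}) (\<lambda>x. p * indicator {p..} x)"
    using \<open>0 \<le> p\<close> by (auto simp: one_good_mech_def split: split_indicator)
  note rev[OF this]
  also have "(\<integral>\<^sup>+x. ennreal (p * indicator {p..} x) \<partial>D) = (\<integral>\<^sup>+x. ennreal p * indicator {p..} x \<partial>D)"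
    by (intro nn_integral_cong) (auto split: split_indicator)
  also have "\<dots> = ennreal (p * measure D {p..})"
    using \<open>0 \<le> p\<close> by (subst nn_integral_cmult_indicator) (auto simp: emeasure_eq_measure ennreal_mult)
  finally show ?thesis using \<open>0 \<le> r\<close> by simp
qed

text \<open>Selling the excess \<open>(g x - g y) / (1 - g y)\<close> of the allocation over the one at the left end \<open>y\<close>
  is itself a one-good mechanism.\<close>

lemma truncated_section_revenue_le:
  fixes D :: "real measure" and g b :: "real \<Rightarrow> real"
  assumes sD[measurable_cong]: "sets D = sets borel"
    and rev: "\<And>q s. one_good_mech q s \<Longrightarrow> (\<integral>\<^sup>+x. ennreal (s x) \<partial>D) \<le> ennreal r"
    and "0 \<le> r" "0 \<le> y"
    and [measurable]: "g \<in> borel_measurable borel" "b \<in> borel_measurable borel"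
    and g01: "\<And>x. y \<le> x \<Longrightarrow> 0 \<le> g x \<and> g x \<le> 1"
    and sub: "\<And>x x'. y \<le> x \<Longrightarrow> y \<le> x' \<Longrightarrow> b x' + g x' * (x - x') \<le> b x"
  shows "(\<integral>\<^sup>+x. ennreal (if y \<le> x then x * g x - b x - (y * g y - b y) else 0) \<partial>D) \<le> ennreal ((1 - g y) * r)"
proof -
  define S where "S x = (if y \<le> x then x * g x - b x - (y * g y - b y) else 0)" for x
  have [measurable]: "S \<in> borel_measurable borel" unfolding S_def[abs_def] by measurable
  have mono: "g y \<le> g x" if "y \<le> x" for x
  proof (cases "x = y")
    case False
    have "g y * (x - y) \<le> g x * (x - y)" using sub[of x y] sub[of y x] that by (simp add: algebra_simps)
    then show ?thesis using False that by (simp add: mult_le_cancel_right)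
  qed simp
  show ?thesis
  \<comment> \<open>Division by \<open>1 - g y\<close> is impossible here, but then the allocation
    is 1 from \<open>y\<close> on and there is no excess payment.\<close>
  proof (cases "g y = 1")
    case True
    have "S x \<le> 0" for x
    proof (cases "y \<le> x")
      case yx: True
      then have "g x = 1" using mono[OF yx] g01[OF yx] True by simp
      then show ?thesis using sub[of x y] yx True by (simp add: S_def)
    qed (simp add: S_def)
    then show ?thesis unfolding S_def[symmetric] by (simp add: ennreal_neg)
  next
    case False
    define c where "c = 1 - g y"
    have c: "0 < c" using False g01[of y] by (simp add: c_def)
    define G where "G x = (if y \<le> x then g x - g y else 0)" for x
    have [measurable]: "G \<in> borel_measurable borel" unfolding G_def[abs_def] by measurable
    have mech: "one_good_mech (\<lambda>x. G x / c) (\<lambda>x. S x / c)"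
      unfolding one_good_mech_def
    proof (intro conjI allI impI)
      fix x :: real assume x: "0 \<le> x"
      show "0 \<le> G x / c" using mono[of x] c by (simp add: G_def)
      show "G x / c \<le> 1" using g01[of x] c by (simp add: G_def c_def)
      show "0 \<le> S x / c"
      proof (cases "y \<le> x")
        case True
        then have "y * g y \<le> y * g x" using mono[OF True] \<open>0 \<le> y\<close> by (intro mult_left_mono)
        then have "0 \<le> S x" using sub[of y x] True by (simp add: S_def algebra_simps)
        then show ?thesis using c by simp
      qed (simp add: S_def)
      show "S x / c \<le> G x / c * x"
        using sub[of x y] c by (auto simp: G_def S_def divide_simps) (simp add: algebra_simps)
      fix x' :: real assume x': "0 \<le> x'"
      have "G x' * x - S x' \<le> G x * x - S x"
      proof (cases "y \<le> x")
        case T: True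
        show ?thesis using T sub[of x x'] sub[of x y] by (auto simp: G_def S_def algebra_simps)
      next
        \<comment> \<open>Types below \<open>y\<close> buy nothing. From a report
          \<open>x' \<ge> y\<close> such a type gains at most what type \<open>y\<close> would, and
          that is not positive.\<close>
        case F: False
        have "(x - y) * (g x' - g y) \<le> 0" if "y \<le> x'"
          using F mono[OF that] by (intro mult_nonpos_nonneg) auto
        then show ?thesis using F sub[of y x'] by (auto simp: G_def S_def algebra_simps)
      qed
      then have "(G x' * x - S x') / c \<le> (G x * x - S x) / c"
        using c by (intro divide_right_mono) auto
      then show "G x' / c * x - S x' / c \<le> G x / c * x - S x / c"
        by (simp add: diff_divide_distrib)
    qed measurable
    have "(\<integral>\<^sup>+x. ennreal (S x) \<partial>D) = (\<integral>\<^sup>+x. ennreal c * ennreal (S x / c) \<partial>D)"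
      using c by (intro nn_integral_cong) (simp add: ennreal_mult'[symmetric])
    also have "\<dots> = ennreal c * (\<integral>\<^sup>+x. ennreal (S x / c) \<partial>D)"
      by (rule nn_integral_cmult) measurable
    also have "\<dots> \<le> ennreal c * ennreal r" by (intro mult_left_mono rev[OF mech]) simp
    finally show ?thesis using c \<open>0 \<le> r\<close> by (simp add: S_def c_def ennreal_mult)
  qed
qed

text \<open>The payment is written as \<open>q1 * x + q2 * y - b\<close>, so that all incentive
  constraints take the subgradient form \<open>sub\<close>. The product measure allows the excess
  over the diagonal to be integrated in the larger coordinate with the smaller one fixed, where the
  one-good bounds apply.\<close>

lemma two_good_revenue_le:
  fixes D1 D2 :: "real measure" and q1 q2 b :: "real \<Rightarrow> real \<Rightarrow> real"
  assumes D1: "prob_space D1" and D2: "prob_space D2"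
    and s1[measurable_cong]: "sets D1 = sets borel" and s2[measurable_cong]: "sets D2 = sets borel"
    and nn1: "AE x in D1. 0 \<le> x" and nn2: "AE x in D2. 0 \<le> x"
    and rev1: "\<And>q s. one_good_mech q s \<Longrightarrow> (\<integral>\<^sup>+x. ennreal (s x) \<partial>D1) \<le> ennreal r1"
    and rev2: "\<And>q s. one_good_mech q s \<Longrightarrow> (\<integral>\<^sup>+x. ennreal (s x) \<partial>D2) \<le> ennreal r2"
    and r: "0 < r1" "0 < r2"
    and m: "case_prod q1 \<in> borel_measurable (borel \<Otimes>\<^sub>M borel)"
      "case_prod q2 \<in> borel_measurable (borel \<Otimes>\<^sub>M borel)"
      "case_prod b \<in> borel_measurable (borel \<Otimes>\<^sub>M borel)"
    and q1: "\<And>x y. 0 \<le> x \<Longrightarrow> 0 \<le> y \<Longrightarrow> 0 \<le> q1 x y \<and> q1 x y \<le> 1"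
    and q2: "\<And>x y. 0 \<le> x \<Longrightarrow> 0 \<le> y \<Longrightarrow> 0 \<le> q2 x y \<and> q2 x y \<le> 1"
    and sub: "\<And>x y x' y'. 0 \<le> x \<Longrightarrow> 0 \<le> y \<Longrightarrow> 0 \<le> x' \<Longrightarrow> 0 \<le> y' \<Longrightarrow>
        b x' y' + q1 x' y' * (x - x') + q2 x' y' * (y - y') \<le> b x y"
    and b0: "b 0 0 = 0"
  shows "(\<integral>\<^sup>+q. ennreal (q1 (fst q) (snd q) * fst q + q2 (fst q) (snd q) * snd q - b (fst q) (snd q)) \<partial>(D1 \<Otimes>\<^sub>M D2))
    \<le> ennreal ((1 + 1 / sqrt (exp 1)) * (r1 + r2))"
proof -
  interpret D1: prob_space D1 by fact
  interpret D2: prob_space D2 by fact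
  interpret P: pair_prob_space D1 D2 ..
  define P where "P = D1 \<Otimes>\<^sub>M D2"
  have sP[measurable_cong]: "sets P = sets (borel \<Otimes>\<^sub>M borel)"
    unfolding P_def by (intro sets_pair_measure_cong s1 s2)
  define z :: "real \<times> real \<Rightarrow> real" where "z q = min (fst q) (snd q)" for q
  define \<phi> where "\<phi> y = q1 y y" for y
  define \<psi> where "\<psi> y = q2 y y" for y
  define \<beta> where "\<beta> y = b y y" for y
  have [measurable]: "z \<in> borel_measurable P" by (simp add: z_def[abs_def])
  have diag: "(\<lambda>y::real. (y, y)) \<in> borel \<rightarrow>\<^sub>M borel \<Otimes>\<^sub>M borel" by simp
  have \<phi>m[measurable]: "\<phi> \<in> borel_measurable borel"
    using measurable_compose[OF diag m(1)] by (simp only: \<phi>_def[abs_def] prod.case)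
  have \<psi>m[measurable]: "\<psi> \<in> borel_measurable borel"
    using measurable_compose[OF diag m(2)] by (simp only: \<psi>_def[abs_def] prod.case)
  have \<beta>m[measurable]: "\<beta> \<in> borel_measurable borel"
    using measurable_compose[OF diag m(3)] by (simp only: \<beta>_def[abs_def] prod.case)
  have \<phi>: "0 \<le> \<phi> y \<and> \<phi> y \<le> 1" and \<psi>: "0 \<le> \<psi> y \<and> \<psi> y \<le> 1" if "0 \<le> y" for y
    using q1[OF that that] q2[OF that that] by (simp_all add: \<phi>_def \<psi>_def)
  have \<beta>sub: "(\<phi> t + \<psi> t) * (t' - t) \<le> \<beta> t' - \<beta> t" if "0 \<le> t" "0 \<le> t'" for t t'
    using sub[of t' t' t t] that by (simp add: \<phi>_def \<psi>_def \<beta>_def algebra_simps)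
  note AE = AE_pair_fst_snd[OF D1 D2 s1 s2 nn1 nn2, folded P_def]
  have tail1: "t * measure D1 {t..} \<le> r1" and tail2: "t * measure D2 {t..} \<le> r2" if "0 \<le> t" for t
    using tail_le_if_one_good_bound[OF D1 s1 rev1 _ that] tail_le_if_one_good_bound[OF D2 s2 rev2 _ that] r
    by auto
  have int: "integrable P z"
    using integrable_min[OF D1 s1 D2 s2 nn1 nn2 tail1 tail2 r] by (simp add: z_def[abs_def] P_def)
  have int\<beta>: "integrable P (\<lambda>q. \<beta> (z q))"
    unfolding P_def z_def
    by (rule integrable_potential_min[OF D1 D2 s1 s2 nn1 nn2 tail1 tail2 r \<phi>m \<psi>m \<beta>m \<phi> \<psi> \<beta>sub])
       (auto simp: \<beta>_def b0)
  have diag_le: "(\<integral>q. \<phi> (snd q) * (z q - r1) \<partial>P) + (\<integral>q. \<psi> (fst q) * (z q - r2) \<partial>P)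
     \<le> (\<integral>q. \<beta> (z q) \<partial>P) + (r1 + r2) / sqrt (exp 1)"
    unfolding P_def z_def
    by (rule diagonal_bound[OF D1 D2 s1 s2 nn1 nn2 tail1 tail2 r \<phi>m \<psi>m \<beta>m \<phi> \<psi> \<beta>sub])
       (auto simp: \<beta>_def b0)
  \<comment> \<open>On the tie \<open>fst q = snd q\<close> both \<open>S1\<close> and \<open>S2\<close> vanish.\<close>
  define S1 where "S1 q = (if snd q \<le> fst q then fst q * q1 (fst q) (snd q) - b (fst q) (snd q)
     - (snd q * q1 (snd q) (snd q) - b (snd q) (snd q)) else 0)" for q
  define S2 where "S2 q = (if fst q \<le> snd q then snd q * q2 (fst q) (snd q) - b (fst q) (snd q)
     - (fst q * q2 (fst q) (fst q) - b (fst q) (fst q)) else 0)" for q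
  have m': "(\<lambda>q. f (fst q) (snd q)) \<in> borel_measurable P"
    if "case_prod f \<in> borel_measurable (borel \<Otimes>\<^sub>M borel)" for f :: "real \<Rightarrow> real \<Rightarrow> real"
    using that unfolding measurable_cong_sets[OF sP refl] case_prod_unfold .
  define Q1 Q2 B where "Q1 = (\<lambda>q. q1 (fst q) (snd q))" and "Q2 = (\<lambda>q. q2 (fst q) (snd q))"
    and "B = (\<lambda>q. b (fst q) (snd q))"
  have [measurable]: "Q1 \<in> borel_measurable P" "Q2 \<in> borel_measurable P" "B \<in> borel_measurable P"
    unfolding Q1_def Q2_def B_def by (intro m' m)+
  have S1_eq: "S1 = (\<lambda>q. if snd q \<le> fst q then fst q * Q1 q - B q - (snd q * \<phi> (snd q) - \<beta> (snd q)) else 0)"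
    and S2_eq: "S2 = (\<lambda>q. if fst q \<le> snd q then snd q * Q2 q - B q - (fst q * \<psi> (fst q) - \<beta> (fst q)) else 0)"
    by (simp_all add: fun_eq_iff S1_def S2_def Q1_def Q2_def B_def \<phi>_def \<psi>_def \<beta>_def)
  have [measurable]: "S1 \<in> borel_measurable P" "S2 \<in> borel_measurable P"
    unfolding S1_eq S2_eq by measurable
  have sect: "(\<lambda>x. f x y) \<in> borel_measurable borel" "(\<lambda>x. f y x) \<in> borel_measurable borel"
    if "case_prod f \<in> borel_measurable (borel \<Otimes>\<^sub>M borel)" for f :: "real \<Rightarrow> real \<Rightarrow> real" and y
    using measurable_compose[OF _ that, of "\<lambda>x. (x, y)" borel] measurable_compose[OF _ that, of "\<lambda>x. (y, x)" borel]
    by simp_all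
  have mono1: "q1 x' y \<le> q1 x y" if "0 \<le> x'" "x' \<le> x" "0 \<le> y" for x x' y
  proof (cases "x = x'")
    case False
    have "q1 x' y * (x - x') \<le> q1 x y * (x - x')"
      using sub[of x y x' y] sub[of x' y x y] that by (simp add: algebra_simps)
    then show ?thesis using False that by (simp add: mult_le_cancel_right)
  qed simp
  have mono2: "q2 x y' \<le> q2 x y" if "0 \<le> y'" "y' \<le> y" "0 \<le> x" for x y y'
  proof (cases "y = y'")
    case False
    have "q2 x y' * (y - y') \<le> q2 x y * (y - y')"
      using sub[of x y x y'] sub[of x y' x y] that by (simp add: algebra_simps)
    then show ?thesis using False that by (simp add: mult_le_cancel_right)
  qed simp
  have S1_nonneg: "0 \<le> S1 (x, y)" if "0 \<le> x" "0 \<le> y" for x y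
  proof (cases "y \<le> x")
    case True
    have "y * q1 y y \<le> y * q1 x y" using mono1[OF that(2) True that(2)] that by (intro mult_left_mono)
    then show ?thesis using sub[of y y x y] True that by (simp add: S1_def algebra_simps)
  qed (simp add: S1_def)
  have S2_nonneg: "0 \<le> S2 (x, y)" if "0 \<le> x" "0 \<le> y" for x y
  proof (cases "x \<le> y")
    case True
    have "x * q2 x x \<le> x * q2 x y" using mono2[OF that(1) True that(1)] that by (intro mult_left_mono)
    then show ?thesis using sub[of x x x y] True that by (simp add: S2_def algebra_simps)
  qed (simp add: S2_def)
  have nnS1: "(\<integral>\<^sup>+q. ennreal (S1 q) \<partial>P) \<le> (\<integral>\<^sup>+q. ennreal ((1 - \<phi> (snd q)) * r1) \<partial>P)"
  proof -
    have "(\<integral>\<^sup>+q. ennreal (S1 q) \<partial>P) = (\<integral>\<^sup>+y. \<integral>\<^sup>+x. ennreal (S1 (x, y)) \<partial>D1 \<partial>D2)"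
      unfolding P_def by (rule P.nn_integral_snd[symmetric]) (simp add: P_def[symmetric])
    also have "\<dots> \<le> (\<integral>\<^sup>+y. \<integral>\<^sup>+x. ennreal ((1 - \<phi> y) * r1) \<partial>D1 \<partial>D2)"
    proof (rule nn_integral_mono_AE)
      show "AE y in D2. (\<integral>\<^sup>+x. ennreal (S1 (x, y)) \<partial>D1) \<le> (\<integral>\<^sup>+x. ennreal ((1 - \<phi> y) * r1) \<partial>D1)"
        using nn2
      proof eventually_elim
        case (elim y)
        have "(\<integral>\<^sup>+x. ennreal (S1 (x, y)) \<partial>D1) \<le> ennreal ((1 - q1 y y) * r1)"
          unfolding S1_def fst_conv snd_conv
        proof (rule truncated_section_revenue_le[OF s1 rev1 _ elim sect(1)[OF m(1)] sect(1)[OF m(3)]])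
          show "0 \<le> q1 x y \<and> q1 x y \<le> 1" if "y \<le> x" for x using q1[of x y] elim that by simp
          show "b x' y + q1 x' y * (x - x') \<le> b x y" if "y \<le> x" "y \<le> x'" for x x'
            using sub[of x y x' y] elim that by simp
        qed (use r in auto)
        then show ?case by (simp add: \<phi>_def D1.emeasure_space_1)
      qed
    qed
    also have "\<dots> = (\<integral>\<^sup>+q. ennreal ((1 - \<phi> (snd q)) * r1) \<partial>P)"
      unfolding P_def by (subst P.nn_integral_snd[symmetric]) simp_all
    finally show ?thesis .
  qed
  have nnS2: "(\<integral>\<^sup>+q. ennreal (S2 q) \<partial>P) \<le> (\<integral>\<^sup>+q. ennreal ((1 - \<psi> (fst q)) * r2) \<partial>P)"
  proof -
    have "(\<integral>\<^sup>+q. ennreal (S2 q) \<partial>P) = (\<integral>\<^sup>+x. \<integral>\<^sup>+y. ennreal (S2 (x, y)) \<partial>D2 \<partial>D1)"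
      unfolding P_def by (rule D2.nn_integral_fst[symmetric]) (simp add: P_def[symmetric])
    also have "\<dots> \<le> (\<integral>\<^sup>+x. \<integral>\<^sup>+y. ennreal ((1 - \<psi> x) * r2) \<partial>D2 \<partial>D1)"
    proof (rule nn_integral_mono_AE)
      show "AE x in D1. (\<integral>\<^sup>+y. ennreal (S2 (x, y)) \<partial>D2) \<le> (\<integral>\<^sup>+y. ennreal ((1 - \<psi> x) * r2) \<partial>D2)"
        using nn1
      proof eventually_elim
        case (elim x)
        have "(\<integral>\<^sup>+y. ennreal (S2 (x, y)) \<partial>D2) \<le> ennreal ((1 - q2 x x) * r2)"
          unfolding S2_def fst_conv snd_conv
        proof (rule truncated_section_revenue_le[OF s2 rev2 _ elim sect(2)[OF m(2)] sect(2)[OF m(3)]])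
          show "0 \<le> q2 x y \<and> q2 x y \<le> 1" if "x \<le> y" for y using q2[of x y] elim that by simp
          show "b x y' + q2 x y' * (y - y') \<le> b x y" if "x \<le> y" "x \<le> y'" for y y'
            using sub[of x y x y'] elim that by simp
        qed (use r in auto)
        then show ?case by (simp add: \<psi>_def D2.emeasure_space_1)
      qed
    qed
    also have "\<dots> = (\<integral>\<^sup>+q. ennreal ((1 - \<psi> (fst q)) * r2) \<partial>P)"
      unfolding P_def by (subst D2.nn_integral_fst[symmetric]) simp_all
    finally show ?thesis .
  qed
  have bounded_int: "integrable P (\<lambda>q. f q * g q)"
    if [measurable]: "f \<in> borel_measurable P" and "integrable P g" "AE q in P. 0 \<le> f q \<and> f q \<le> 1"
    for f g :: "real \<times> real \<Rightarrow> real"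
  proof (rule Bochner_Integration.integrable_bound[OF that(2)])
    show "AE q in P. norm (f q * g q) \<le> norm (g q)"
      using that(3) by eventually_elim (auto simp: abs_mult intro!: mult_left_le_one_le)
    show "(\<lambda>q. f q * g q) \<in> borel_measurable P" using that(2) by measurable
  qed
  have AE\<phi>: "AE q in P. 0 \<le> \<phi> (snd q) \<and> \<phi> (snd q) \<le> 1" using AE by eventually_elim (use \<phi> in auto)
  have AE\<psi>: "AE q in P. 0 \<le> \<psi> (fst q) \<and> \<psi> (fst q) \<le> 1" using AE by eventually_elim (use \<psi> in auto)
  have intc: "integrable P (\<lambda>_. c)" for c :: real by (simp add: P_def)
  have i\<phi>: "integrable P (\<lambda>q. \<phi> (snd q) * (z q - c))" and i\<psi>: "integrable P (\<lambda>q. \<psi> (fst q) * (z q - c))" for c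
    by (intro bounded_int AE\<phi> AE\<psi> Bochner_Integration.integrable_diff int intc; measurable)+
  have AE1\<phi>: "AE q in P. 0 \<le> 1 - \<phi> (snd q) \<and> 1 - \<phi> (snd q) \<le> 1" using AE\<phi> by eventually_elim auto
  have AE1\<psi>: "AE q in P. 0 \<le> 1 - \<psi> (fst q) \<and> 1 - \<psi> (fst q) \<le> 1" using AE\<psi> by eventually_elim auto
  have i1: "integrable P (\<lambda>q. (1 - \<phi> (snd q)) * r1)" by (rule bounded_int[OF _ intc AE1\<phi>]) measurable
  have i2: "integrable P (\<lambda>q. (1 - \<psi> (fst q)) * r2)" by (rule bounded_int[OF _ intc AE1\<psi>]) measurable
  \<comment> \<open>The bounds on \<open>S1\<close> and \<open>S2\<close> have to become real
    integrals because they are combined with terms that are subtracted.\<close>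
  have real_of_nn: "integrable P S \<and> (\<integral>q. S q \<partial>P) \<le> (\<integral>q. g q \<partial>P)"
    if [measurable]: "S \<in> borel_measurable P" and "AE q in P. 0 \<le> S q" "integrable P g" "AE q in P. 0 \<le> g q"
      and le: "(\<integral>\<^sup>+q. ennreal (S q) \<partial>P) \<le> (\<integral>\<^sup>+q. ennreal (g q) \<partial>P)" for S g :: "real \<times> real \<Rightarrow> real"
  proof -
    have g: "(\<integral>\<^sup>+q. ennreal (g q) \<partial>P) = ennreal (\<integral>q. g q \<partial>P)"
      by (rule nn_integral_eq_integral) fact+
    have S: "integrable P S"
      by (rule integrableI_nonneg) (use that g in \<open>auto intro: le_less_trans\<close>)
    have "ennreal (\<integral>q. S q \<partial>P) \<le> ennreal (\<integral>q. g q \<partial>P)"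
      using le g nn_integral_eq_integral[OF S that(2)] by simp
    then show ?thesis using S integral_nonneg_AE[OF that(4)] by simp
  qed
  have AES1: "AE q in P. 0 \<le> S1 q" and AES2: "AE q in P. 0 \<le> S2 q"
    using AE by (eventually_elim, use S1_nonneg S2_nonneg in force)+
  have R1: "integrable P S1 \<and> (\<integral>q. S1 q \<partial>P) \<le> (\<integral>q. (1 - \<phi> (snd q)) * r1 \<partial>P)"
    by (rule real_of_nn[OF _ AES1 i1 _ nnS1]) (use AE\<phi> r in \<open>auto elim: eventually_mono\<close>)
  have R2: "integrable P S2 \<and> (\<integral>q. S2 q \<partial>P) \<le> (\<integral>q. (1 - \<psi> (fst q)) * r2 \<partial>P)"
    by (rule real_of_nn[OF _ AES2 i2 _ nnS2]) (use AE\<psi> r in \<open>auto elim: eventually_mono\<close>)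
  \<comment> \<open>\<open>T\<close> majorises the payment on both sides of the diagonal. The form
    \<open>z q - 0\<close> makes its terms the case \<open>c = 0\<close> of \<open>i\<phi>\<close>
    and \<open>i\<psi>\<close>.\<close>
  define T where "T q = S1 q + S2 q + \<phi> (snd q) * (z q - 0) + \<psi> (fst q) * (z q - 0) - \<beta> (z q)" for q
  have intT: "integrable P T"
    unfolding T_def[abs_def]
    by (intro Bochner_Integration.integrable_diff Bochner_Integration.integrable_add i\<phi> i\<psi> int\<beta> conjunct1[OF R1] conjunct1[OF R2])
  have T_le: "(\<integral>q. T q \<partial>P) \<le> (1 + 1 / sqrt (exp 1)) * (r1 + r2)"
  proof -
    \<comment> \<open>The part \<open>\<phi> * r1\<close> missing from the one-good revenue turns
      the weight \<open>z\<close> into \<open>z - r1\<close>.\<close>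
    have split\<phi>: "(\<integral>q. (1 - \<phi> (snd q)) * r1 \<partial>P) + (\<integral>q. \<phi> (snd q) * (z q - 0) \<partial>P)
      = r1 + (\<integral>q. \<phi> (snd q) * (z q - r1) \<partial>P)"
    proof -
      have "(\<integral>q. (1 - \<phi> (snd q)) * r1 \<partial>P) + (\<integral>q. \<phi> (snd q) * (z q - 0) \<partial>P)
        = (\<integral>q. r1 + \<phi> (snd q) * (z q - r1) \<partial>P)"
        by (subst Bochner_Integration.integral_add[symmetric, OF i1 i\<phi>]) (simp add: algebra_simps)
      also have "\<dots> = r1 + (\<integral>q. \<phi> (snd q) * (z q - r1) \<partial>P)"
        using Bochner_Integration.integral_add[OF intc i\<phi>] by (simp add: P_def P.prob_space)
      finally show ?thesis .
    qed
    have split\<psi>: "(\<integral>q. (1 - \<psi> (fst q)) * r2 \<partial>P) + (\<integral>q. \<psi> (fst q) * (z q - 0) \<partial>P)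
      = r2 + (\<integral>q. \<psi> (fst q) * (z q - r2) \<partial>P)"
    proof -
      have "(\<integral>q. (1 - \<psi> (fst q)) * r2 \<partial>P) + (\<integral>q. \<psi> (fst q) * (z q - 0) \<partial>P)
        = (\<integral>q. r2 + \<psi> (fst q) * (z q - r2) \<partial>P)"
        by (subst Bochner_Integration.integral_add[symmetric, OF i2 i\<psi>]) (simp add: algebra_simps)
      also have "\<dots> = r2 + (\<integral>q. \<psi> (fst q) * (z q - r2) \<partial>P)"
        using Bochner_Integration.integral_add[OF intc i\<psi>] by (simp add: P_def P.prob_space)
      finally show ?thesis .
    qed
    have "(\<integral>q. T q \<partial>P) = (\<integral>q. S1 q \<partial>P) + (\<integral>q. S2 q \<partial>P) + (\<integral>q. \<phi> (snd q) * (z q - 0) \<partial>P)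
       + (\<integral>q. \<psi> (fst q) * (z q - 0) \<partial>P) - (\<integral>q. \<beta> (z q) \<partial>P)"
      unfolding T_def using i\<phi>[of 0] i\<psi>[of 0] int\<beta> R1 R2
      by (simp add: Bochner_Integration.integral_diff Bochner_Integration.integral_add
          Bochner_Integration.integrable_diff Bochner_Integration.integrable_add)
    also have "\<dots> \<le> r1 + r2 + (r1 + r2) / sqrt (exp 1)"
      using split\<phi> split\<psi> R1 R2 diag_le by linarith
    finally show ?thesis by (simp add: algebra_simps add_divide_distrib)
  qed
  have pt: "q1 x y * x + q2 x y * y - b x y \<le> T (x, y)" if xy: "0 \<le> x" "0 \<le> y" for x y
  proof (cases "y \<le> x")
    case True
    have "y * q2 x y \<le> y * q2 x x" using mono2[OF xy(2) True xy(1)] xy by (intro mult_left_mono)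
    then show ?thesis using True S2_nonneg[OF xy]
      by (simp add: T_def S1_def z_def \<phi>_def \<psi>_def \<beta>_def min_absorb2 algebra_simps)
  next
    case False
    then have le: "x \<le> y" by simp
    have "x * q1 x y \<le> x * q1 y y" using mono1[OF xy(1) le xy(2)] xy by (intro mult_left_mono)
    then show ?thesis using le S1_nonneg[OF xy]
      by (simp add: T_def S2_def z_def \<phi>_def \<psi>_def \<beta>_def min_absorb1 algebra_simps)
  qed
  \<comment> \<open>The zero type has payoff 0 and cannot gain by reporting \<open>(x, y)\<close>,
    so the payment there is not negative.\<close>
  have pos: "0 \<le> q1 x y * x + q2 x y * y - b x y" if "0 \<le> x" "0 \<le> y" for x y
    using sub[of 0 0 x y] that b0 by simp
  have AET: "AE q in P. 0 \<le> T q"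
    using AE
  proof eventually_elim
    case (elim q)
    then show ?case using order_trans[OF pos[of "fst q" "snd q"] pt[of "fst q" "snd q"]] by simp
  qed
  have "(\<integral>\<^sup>+q. ennreal (q1 (fst q) (snd q) * fst q + q2 (fst q) (snd q) * snd q - b (fst q) (snd q)) \<partial>P)
    \<le> (\<integral>\<^sup>+q. ennreal (T q) \<partial>P)"
  proof (rule nn_integral_mono_AE)
    show "AE q in P. ennreal (q1 (fst q) (snd q) * fst q + q2 (fst q) (snd q) * snd q - b (fst q) (snd q)) \<le> ennreal (T q)"
      using AE
    proof eventually_elim
      case (elim q)
      then show ?case using pt[of "fst q" "snd q"] by (simp add: ennreal_leI)
    qed
  qed
  also have "\<dots> = ennreal (\<integral>q. T q \<partial>P)"
    by (rule nn_integral_eq_integral[OF intT AET])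
  also have "\<dots> \<le> ennreal ((1 + 1 / sqrt (exp 1)) * (r1 + r2))"
    by (rule ennreal_leI[OF T_le])
  finally show ?thesis by (simp add: P_def)
qed

section \<open>Revenues of mechanisms\<close>

text \<open>The scalar mechanism is transported to \<open>real^1\<close>. Its payments are
  nonnegative on the values taken, so \<open>neg_pay\<close> vanishes, the mechanism is admissible
  in \<open>Rev\<close>, and its revenue is the plain integral.\<close>

lemma one_good_revenue_le_Rev:
  assumes X[measurable]: "X \<in> borel_measurable M" and nn: "\<forall>\<omega>\<in>space M. 0 \<le> X \<omega>"
    and mech: "one_good_mech q s"
  shows "enn2ereal (\<integral>\<^sup>+x. ennreal (s x) \<partial>distr M borel X) \<le> Rev M (one_good X)"
proof -
  have [measurable]: "q \<in> borel_measurable borel" "s \<in> borel_measurable borel"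
    using mech by (auto simp: one_good_mech_def)
  define q' :: "real^1 \<Rightarrow> real^1" where "q' v = (\<chi> i. q (v $ 1))" for v
  define s' :: "real^1 \<Rightarrow> real" where "s' v = s (v $ 1)" for v
  have nth[measurable]: "(\<lambda>v :: real^1. v $ 1) \<in> borel_measurable borel"
    by (intro borel_measurable_continuous_onI continuous_intros)
  have "q' = (\<lambda>v. q (v $ 1) *\<^sub>R (\<chi> i. 1))" by (auto simp: q'_def vec_eq_iff)
  then have "q' \<in> borel_measurable borel" by simp
  moreover have "s' \<in> borel_measurable borel" unfolding s'_def[abs_def] by measurable
  ultimately have IC: "IC_IR_mechanism q' s'"
    using mech unfolding one_good_mech_def IC_IR_mechanism_def nonneg_orthant_def q'_def s'_def
    by (simp add: inner_vec_def sum_1 forall_1)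
  have pos: "pos_pay M (one_good X) s' = (\<integral>\<^sup>+x. ennreal (s x) \<partial>distr M borel X)"
    by (subst nn_integral_distr) (simp_all add: pos_pay_def one_good_def s'_def vector_1)
  have "neg_pay M (one_good X) s' = (\<integral>\<^sup>+\<omega>. 0 \<partial>M)"
    unfolding neg_pay_def
    by (rule nn_integral_cong)
       (use mech nn in \<open>auto simp: one_good_def s'_def vector_1 one_good_mech_def ennreal_neg\<close>)
  then have neg: "neg_pay M (one_good X) s' = 0" by simp
  have "revenue M (one_good X) (snd (q', s')) \<le> Rev M (one_good X)"
    unfolding Rev_def by (rule SUP_upper) (use IC neg in auto)
  then show ?thesis by (simp add: revenue_def pos neg zero_ennreal.rep_eq)
qed

lemma Rev_one_good_nonneg:
  assumes "X \<in> borel_measurable M" "\<forall>\<omega>\<in>space M. 0 \<le> X \<omega>"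
  shows "0 \<le> Rev M (one_good X)"
proof -
  have "one_good_mech (\<lambda>_. 0) (\<lambda>_. 0)" by (simp add: one_good_mech_def)
  from one_good_revenue_le_Rev[OF assms this] show ?thesis by (simp add: zero_ennreal.rep_eq)
qed

text \<open>Independence turns the joint law into a product, to which
  \<open>two_good_revenue_le\<close> applies. The bounds \<open>r1\<close> and \<open>r2\<close> are
  strictly positive upper bounds instead of the revenues themselves, which may be 0, because the
  estimates take logarithms of quotients by them.\<close>

lemma revenue_two_goods_le:
  fixes M :: "'a measure" and X1 X2 :: "'a \<Rightarrow> real"
  assumes "prob_space M"
    and X[measurable]: "X1 \<in> borel_measurable M" "X2 \<in> borel_measurable M"
    and nn: "\<forall>\<omega>\<in>space M. 0 \<le> X1 \<omega>" "\<forall>\<omega>\<in>space M. 0 \<le> X2 \<omega>"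
    and ind: "prob_space.indep_var M borel X1 borel X2"
    and rev1: "Rev M (one_good X1) \<le> ereal r1" and rev2: "Rev M (one_good X2) \<le> ereal r2"
    and r: "0 < r1" "0 < r2"
    and mech: "IC_IR_mechanism q s"
  shows "revenue M (two_goods X1 X2) s \<le> ereal ((1 + 1 / sqrt (exp 1)) * (r1 + r2))"
proof -
  interpret prob_space M by fact
  define D1 where "D1 = distr M borel X1"
  define D2 where "D2 = distr M borel X2"
  have D: "prob_space D1" "prob_space D2" and sD: "sets D1 = sets borel" "sets D2 = sets borel"
    by (auto simp: D1_def D2_def intro: prob_space_distr)
  have nnD: "AE x in D1. 0 \<le> x" "AE x in D2. 0 \<le> x"
    unfolding D1_def D2_def by (subst AE_distr_iff; use nn in auto)+
  have rev: "(\<integral>\<^sup>+x. ennreal (s x) \<partial>distr M borel Y) \<le> ennreal r"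
    if "Y \<in> borel_measurable M" "\<forall>\<omega>\<in>space M. 0 \<le> Y \<omega>" "Rev M (one_good Y) \<le> ereal r" "0 < r"
      "one_good_mech q s" for Y r q s
  proof -
    have "enn2ereal (\<integral>\<^sup>+x. ennreal (s x) \<partial>distr M borel Y) \<le> ereal r"
      using one_good_revenue_le_Rev[OF that(1,2,5)] that(3) by (rule order_trans)
    then show ?thesis using that(4) by (simp add: less_eq_ennreal.rep_eq)
  qed
  define v :: "real \<Rightarrow> real \<Rightarrow> real^2" where "v x y = vector [x, y]" for x y
  have v_nth: "v x y $ 1 = x" "v x y $ 2 = y" for x y by (simp_all add: v_def)
  have v_axis: "case_prod v = (\<lambda>p. fst p *\<^sub>R axis 1 1 + snd p *\<^sub>R axis 2 1)"
    by (auto simp: fun_eq_iff vec_eq_iff forall_2 v_nth axis_def)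
  have vm[measurable]: "case_prod v \<in> borel_measurable (borel \<Otimes>\<^sub>M borel)"
    unfolding v_axis by measurable
  have vmem: "v x y \<in> nonneg_orthant" if "0 \<le> x" "0 \<le> y" for x y
    using that by (simp add: nonneg_orthant_def forall_2 v_nth)
  have qm: "q \<in> borel_measurable borel" and sm: "s \<in> borel_measurable borel"
    using mech by (auto simp: IC_IR_mechanism_def)
  define q1 where "q1 x y = q (v x y) $ 1" for x y
  define q2 where "q2 x y = q (v x y) $ 2" for x y
  \<comment> \<open>Adding \<open>c \<le> 0\<close> to the payoff makes it vanish at the origin and only raises payments, so that they become nonnegative.\<close>
  define c where "c = s (v 0 0)"
  define b where "b x y = q1 x y * x + q2 x y * y - s (v x y) + c" for x y
  have inner_v: "q (v x y) \<bullet> v x' y' = q1 x y * x' + q2 x y * y'" for x y x' y'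
    by (simp add: inner_vec_def sum_2 v_nth q1_def q2_def)
  have nth: "(\<lambda>w :: real^2. w $ i) \<in> borel_measurable borel" for i
    by (intro borel_measurable_continuous_onI continuous_intros)
  have m1[measurable]: "(\<lambda>p. q (case_prod v p) $ i) \<in> borel_measurable (borel \<Otimes>\<^sub>M borel)" for i
    by (rule measurable_compose[OF measurable_compose[OF vm qm] nth])
  have m2[measurable]: "(\<lambda>p. s (case_prod v p)) \<in> borel_measurable (borel \<Otimes>\<^sub>M borel)"
    by (rule measurable_compose[OF vm sm])
  have e1: "case_prod q1 = (\<lambda>p. q (case_prod v p) $ 1)" and e2: "case_prod q2 = (\<lambda>p. q (case_prod v p) $ 2)"
    and e3: "case_prod b = (\<lambda>p. q (case_prod v p) $ 1 * fst p + q (case_prod v p) $ 2 * snd p - s (case_prod v p) + c)"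
    by (auto simp: fun_eq_iff q1_def q2_def b_def)
  \<comment> \<open>Individual rationality at the origin, where the inner product is 0.\<close>
  have "0 \<le> q (v 0 0) \<bullet> v 0 0 - s (v 0 0)"
    using mech vmem[of 0 0] by (auto simp: IC_IR_mechanism_def)
  then have c: "c \<le> 0" by (simp add: inner_v c_def)
  let ?P = "D1 \<Otimes>\<^sub>M D2"
  have joint: "?P = distr M (borel \<Otimes>\<^sub>M borel) (\<lambda>\<omega>. (X1 \<omega>, X2 \<omega>))"
    using ind by (simp add: indep_var_distribution_eq D1_def D2_def)
  have "revenue M (two_goods X1 X2) s \<le> enn2ereal (pos_pay M (two_goods X1 X2) s)"
    unfolding revenue_def by (rule ereal_diff_le_self) simp
  also have "pos_pay M (two_goods X1 X2) s = (\<integral>\<^sup>+p. ennreal (s (case_prod v p)) \<partial>?P)"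
    unfolding joint pos_pay_def by (subst nn_integral_distr) (simp_all add: two_goods_def v_def)
  also have "\<dots> \<le> (\<integral>\<^sup>+p. ennreal (q1 (fst p) (snd p) * fst p + q2 (fst p) (snd p) * snd p - b (fst p) (snd p)) \<partial>?P)"
    using c by (intro nn_integral_mono ennreal_leI) (auto simp: b_def)
  also have "\<dots> \<le> ennreal ((1 + 1 / sqrt (exp 1)) * (r1 + r2))"
  proof (rule two_good_revenue_le[OF D sD nnD _ _ r])
    show "(\<integral>\<^sup>+x. ennreal (s x) \<partial>D1) \<le> ennreal r1" if "one_good_mech q s" for q s
      unfolding D1_def by (rule rev[OF X(1) nn(1) rev1 r(1) that])
    show "(\<integral>\<^sup>+x. ennreal (s x) \<partial>D2) \<le> ennreal r2" if "one_good_mech q s" for q s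
      unfolding D2_def by (rule rev[OF X(2) nn(2) rev2 r(2) that])
    show "case_prod q1 \<in> borel_measurable (borel \<Otimes>\<^sub>M borel)" "case_prod q2 \<in> borel_measurable (borel \<Otimes>\<^sub>M borel)"
      unfolding e1 e2 by (rule m1)+
    show "case_prod b \<in> borel_measurable (borel \<Otimes>\<^sub>M borel)"
      unfolding e3
      by (intro borel_measurable_add borel_measurable_diff borel_measurable_times m1 m2
          measurable_fst measurable_snd measurable_const) simp_all
    show "0 \<le> q1 x y \<and> q1 x y \<le> 1" "0 \<le> q2 x y \<and> q2 x y \<le> 1" if "0 \<le> x" "0 \<le> y" for x y
      using mech vmem[OF that] by (auto simp: IC_IR_mechanism_def q1_def q2_def)
    show "b x' y' + q1 x' y' * (x - x') + q2 x' y' * (y - y') \<le> b x y"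
      if "0 \<le> x" "0 \<le> y" "0 \<le> x'" "0 \<le> y'" for x y x' y'
    proof -
      have "q (v x' y') \<bullet> v x y - s (v x' y') \<le> q (v x y) \<bullet> v x y - s (v x y)"
        using mech vmem[OF that(1,2)] vmem[OF that(3,4)] by (auto simp: IC_IR_mechanism_def)
      then show ?thesis by (simp add: inner_v b_def algebra_simps)
    qed
    show "b 0 0 = 0" by (simp add: b_def c_def)
  qed
  finally show ?thesis
    using r by (simp add: less_eq_ennreal.rep_eq enn2ereal_ennreal)
qed

theorem theorem1:
  fixes M :: "'a measure" and X1 X2 :: "'a \<Rightarrow> real"
  assumes "prob_space M"
    and "X1 \<in> borel_measurable M" and "X2 \<in> borel_measurable M"
    and "\<forall>\<omega>\<in>space M. 0 \<le> X1 \<omega>" and "\<forall>\<omega>\<in>space M. 0 \<le> X2 \<omega>"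
    and "prob_space.indep_var M borel X1 borel X2"
  shows "SRev2 M X1 X2 \<ge> ereal (sqrt (exp 1) / (sqrt (exp 1) + 1)) * Rev M (two_goods X1 X2)"
proof -
  define R1 R2 where "R1 = Rev M (one_good X1)" and "R2 = Rev M (one_good X2)"
  have R0: "0 \<le> R1" "0 \<le> R2"
    unfolding R1_def R2_def using assms Rev_one_good_nonneg by blast+
  show ?thesis
  proof (cases "R1 = \<infinity> \<or> R2 = \<infinity>")
    case True
    then have "SRev2 M X1 X2 = \<infinity>"
      using R0 by (auto simp: SRev2_def R1_def[symmetric] R2_def[symmetric])
    then show ?thesis by simp
  next
    case False
    then obtain \<rho>1 \<rho>2 where \<rho>: "R1 = ereal \<rho>1" "R2 = ereal \<rho>2"
      using R0 by (cases R1; cases R2) auto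
    have \<rho>0: "0 \<le> \<rho>1" "0 \<le> \<rho>2" using R0 \<rho> by auto
    \<comment> \<open>The reciprocal of the constant in the claim.\<close>
    define k where "k = 1 + 1 / sqrt (exp (1::real))"
    have k: "0 < k" by (simp add: k_def add_pos_pos)
    have "Rev M (two_goods X1 X2) \<le> ereal (k * (\<rho>1 + \<rho>2))"
      unfolding Rev_def
    proof (rule SUP_least)
      fix qs :: "(real^2 \<Rightarrow> real^2) \<times> (real^2 \<Rightarrow> real)"
      assume "qs \<in> {(q, s). IC_IR_mechanism q s \<and>
        \<not> (pos_pay M (two_goods X1 X2) s = \<top> \<and> neg_pay M (two_goods X1 X2) s = \<top>)}"
      then have mech: "IC_IR_mechanism (fst qs) (snd qs)" by auto
      show "revenue M (two_goods X1 X2) (snd qs) \<le> ereal (k * (\<rho>1 + \<rho>2))"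
      proof (rule ereal_le_epsilon2)
        fix e :: real assume e: "0 < e"
        \<comment> \<open>Both revenues are raised by \<open>d\<close> to make them positive; the
          total cost \<open>2 * k * d\<close> is exactly \<open>e\<close>.\<close>
        define d where "d = e / (2 * k)"
        have d: "0 < d" using e k by (simp add: d_def)
        have "revenue M (two_goods X1 X2) (snd qs) \<le> ereal (k * ((\<rho>1 + d) + (\<rho>2 + d)))"
          unfolding k_def
          by (rule revenue_two_goods_le[OF assms(1-6) _ _ _ _ mech])
             (use d \<rho> \<rho>0 in \<open>auto simp: R1_def R2_def\<close>)
        also have "k * ((\<rho>1 + d) + (\<rho>2 + d)) = k * (\<rho>1 + \<rho>2) + e"
          using k by (simp add: d_def field_simps)
        finally show "revenue M (two_goods X1 X2) (snd qs) \<le> ereal (k * (\<rho>1 + \<rho>2)) + ereal e" by simp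
      qed
    qed
    then have "ereal (1 / k) * Rev M (two_goods X1 X2) \<le> ereal (1 / k) * ereal (k * (\<rho>1 + \<rho>2))"
      using k by (intro ereal_mult_left_mono) auto
    also have "\<dots> = SRev2 M X1 X2"
      using k \<rho> by (simp add: SRev2_def R1_def R2_def)
    also have "1 / k = sqrt (exp 1) / (sqrt (exp 1) + 1)"
      by (simp add: k_def field_simps)
    finally show ?thesis .
  qed
qed

end
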